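(* Let $n>d\ge 1$ be integers, let $\bm{A}\in\mathbb{R}^{d\times(n-d)}$, $\bm{\alpha}_0\in\mathbb{R}^{1\times(n-d)}$, and let $\widetilde{\bm{A}}=\binom{\bm{\alpha}_0}{\bm{A}}\in\mathbb{R}^{(d+1)\times(n-d)}$. Let $\mathscr{H}=\{(\bm{x},\widetilde{\bm{x}}\cdot\widetilde{\bm{A}}):\bm{x}\in\mathbb{R}^d\}\subset\mathbb{R}^n$, where $\widetilde{\bm{x}}=(1,\bm{x})$. Then: (a) if $\omega(\bm{A})<dn$, then $\mathscr{H}$ is of strong Khintchine type for convergence, i.e. $|\mathscr{H}\cap\mathscr{S}_n(\psi)|_{\mathscr{H}}=0$ for every function $\psi:\mathbb{N}\to\mathbb{R}_{\ge0}$ with $\sum_{q=1}^\infty\psi(q)^n<\infty$; (b) if $\omega(\widetilde{\bm{A}})<(d+1)n$, then $\mathscr{H}$ is of Khintchine type for convergence, i.e. $|\mathscr{H}\cap\mathscr{S}_n(\psi)|_{\mathscr{H}}=0$ for every non-increasing function $\psi:\mathbb{N}\to\mathbb{R}_{\ge0}$ with $\sum_{q=1}^\infty\psi(q)^n<\infty$.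
   Context: Vectors are row vectors. For $y\in\mathbb{R}$, $\|y\|$ denotes the distance from $y$ to the nearest integer, and for $\bm{y}=(y_1,\dots,y_n)\in\mathbb{R}^n$, $\|\bm{y}\|=\max_k\|y_k\|$; $|\bm{y}|$ is the supremum norm. For $\psi:\mathbb{N}\to\mathbb{R}_{\ge0}$, $\mathscr{S}_n(\psi)=\{\bm{x}\in\mathbb{R}^n: \|q\bm{x}\|<\psi(q)\text{ for infinitely many }q\in\mathbb{N}\}$. $|\cdot|_{\mathscr{H}}$ is the induced Lebesgue measure on $\mathscr{H}$. For a matrix $\bm{M}\in\mathbb{R}^{l\times m}$ with rows $\mathrm{row}_u(\bm{M})$, its (multiplicative) diophantine type $\omega(\bm{M})$ is the supremum of all $\omega$ for which $\prod_{u=1}^l\|\bm{j}\cdot\mathrm{row}_u(\bm{M})\|<|\bm{j}|^{-\omega}$ has infinitely many solutions $\bm{j}\in\mathbb{Z}^m$. *)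

theory Defs
  imports "HOL-Analysis.Analysis"
begin

text \<open>Vectors are row vectors. With \<open>d = CARD('d)\<close> and \<open>n - d = CARD('m)\<close>, the space
  \<open>\<real>\<^sup>n\<close> is \<^typ>\<open>real ^ ('d + 'm)\<close>. Throughout, \<open>\<nat>\<close> means the positive integers; the
  value of an approximation function at \<open>0\<close> is never used.\<close>

definition dist_int :: "real \<Rightarrow> real" where
  "dist_int y = \<bar>y - of_int (round y)\<bar>"

definition dist_int_vec :: "real ^ 'n \<Rightarrow> real" where
  "dist_int_vec y = Max (range (\<lambda>k. dist_int (y $ k)))"

definition simul_approx :: "(nat \<Rightarrow> real) \<Rightarrow> (real ^ 'n) set" where
  "simul_approx \<psi> = {x. infinite {q. q \<ge> 1 \<and> dist_int_vec (real q *\<^sub>R x) < \<psi> q}}"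

definition real_vec :: "int ^ 'm \<Rightarrow> real ^ 'm" where
  "real_vec j = (\<chi> k. of_int (j $ k))"

text \<open>The supremum may be infinite. The vector \<open>j = 0\<close> is irrelevant for the existence of
  infinitely many solutions.\<close>

definition dioph_type :: "real ^ 'm ^ 'l \<Rightarrow> ereal" where
  "dioph_type M = Sup {ereal \<omega> | \<omega>.
     infinite {j :: int ^ 'm.
       (\<Prod>u\<in>UNIV. dist_int (real_vec j \<bullet> row u M)) < infnorm (real_vec j) powr (- \<omega>)}}"

definition adjoin_one :: "real ^ 'd \<Rightarrow> real ^ ('d option)" where
  "adjoin_one x = (\<chi> i. case i of None \<Rightarrow> 1 | Some k \<Rightarrow> x $ k)"

definition adjoin_row :: "real ^ 'm \<Rightarrow> real ^ 'm ^ 'd \<Rightarrow> real ^ 'm ^ ('d option)" where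
  "adjoin_row \<alpha> A = (\<chi> i. case i of None \<Rightarrow> \<alpha> | Some k \<Rightarrow> A $ k)"

definition append_vec :: "real ^ 'd \<Rightarrow> real ^ 'm \<Rightarrow> real ^ ('d + 'm)" where
  "append_vec x y = (\<chi> i. case i of Inl k \<Rightarrow> x $ k | Inr k \<Rightarrow> y $ k)"

definition aff_param :: "real ^ 'm \<Rightarrow> real ^ 'm ^ 'd \<Rightarrow> real ^ 'd \<Rightarrow> real ^ ('d + 'm)" where
  "aff_param \<alpha> A x = append_vec x (adjoin_one x v* adjoin_row \<alpha> A)"

definition aff_subspace :: "real ^ 'm \<Rightarrow> real ^ 'm ^ 'd \<Rightarrow> (real ^ ('d + 'm)) set" where
  "aff_subspace \<alpha> A = {aff_param \<alpha> A x | x. True}"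

text \<open>The \<open>d\<close>-dimensional Lebesgue measure induced on the graph \<open>{(x, \<alpha> + x A)}\<close> by the Euclidean
  structure of the ambient space: the image of Lebesgue measure under the parametrization, times
  the Gram factor \<open>sqrt (det (J\<^sup>T J))\<close>, where the Jacobian \<open>J\<close> of the parametrization satisfies
  \<open>J\<^sup>T J = I + A A\<^sup>T\<close>.\<close>

definition gram_factor :: "real ^ 'm ^ 'd \<Rightarrow> real" where
  "gram_factor A = sqrt (det (mat 1 + A ** transpose A))"

definition induced_lebesgue :: "real ^ 'm \<Rightarrow> real ^ 'm ^ 'd \<Rightarrow> (real ^ ('d + 'm)) measure" where
  "induced_lebesgue \<alpha> A = completion (scale_measure (ennreal (gram_factor A))
     (distr lborel (restrict_space borel (aff_subspace \<alpha> A)) (aff_param \<alpha> A)))"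

text \<open>Membership in \<^const>\<open>null_sets\<close> asserts measurability as well as measure zero; equality
  of \<^const>\<open>emeasure\<close> with \<open>0\<close> would hold for every non-measurable set.\<close>

definition strong_Khintchine_convergence ::
    "(real ^ 'n) set \<Rightarrow> (real ^ 'n) measure \<Rightarrow> bool" where
  "strong_Khintchine_convergence H \<mu> \<longleftrightarrow>
     (\<forall>\<psi> :: nat \<Rightarrow> real. (\<forall>q\<ge>1. \<psi> q \<ge> 0) \<longrightarrow> summable (\<lambda>q. \<psi> (Suc q) ^ CARD('n)) \<longrightarrow>
        H \<inter> simul_approx \<psi> \<in> null_sets \<mu>)"

definition Khintchine_convergence ::
    "(real ^ 'n) set \<Rightarrow> (real ^ 'n) measure \<Rightarrow> bool" where
  "Khintchine_convergence H \<mu> \<longleftrightarrow>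
     (\<forall>\<psi> :: nat \<Rightarrow> real. (\<forall>q\<ge>1. \<psi> q \<ge> 0) \<longrightarrow> antimono_on {1..} \<psi> \<longrightarrow>
        summable (\<lambda>q. \<psi> (Suc q) ^ CARD('n)) \<longrightarrow>
        H \<inter> simul_approx \<psi> \<in> null_sets \<mu>)"

text \<open>Sanity checks: the parametrization is measurable into the subspace and the Gram factor
  is positive, so the induced measure is not degenerate.\<close>

lemma aff_param_eq: "aff_param \<alpha> A x = append_vec x (\<alpha> + x v* A)"
proof -
  have "(\<Sum>i\<in>UNIV. f i) = f None + (\<Sum>k\<in>UNIV. f (Some k))" for f :: "'a option \<Rightarrow> real"
    by (simp add: UNIV_option_conv sum.reindex)
  then have "adjoin_one x v* adjoin_row \<alpha> A = \<alpha> + x v* A"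
    by (simp add: vec_eq_iff vector_matrix_mult_def adjoin_one_def adjoin_row_def)
  then show ?thesis
    by (simp add: aff_param_def)
qed

lemma continuous_aff_param: "continuous_on UNIV (aff_param \<alpha> A)"
proof -
  have "continuous_on UNIV (\<lambda>x. aff_param \<alpha> A x $ i)" for i
  proof (cases i)
    case (Inl k)
    then show ?thesis
      by (auto simp: aff_param_eq append_vec_def intro!: continuous_intros)
  next
    case (Inr k)
    then show ?thesis
      by (auto simp: aff_param_eq append_vec_def vector_matrix_mult_def intro!: continuous_intros)
  qed
  then have "continuous_on UNIV (\<lambda>x. \<chi> i. aff_param \<alpha> A x $ i)"
    by (rule continuous_on_vec_lambda)
  then show ?thesis
    by simp
qed

lemma measurable_aff_param:
  "aff_param \<alpha> A \<in> lborel \<rightarrow>\<^sub>M restrict_space borel (aff_subspace \<alpha> A)"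
  by (rule measurable_restrict_space2)
    (auto simp: aff_subspace_def intro: borel_measurable_continuous_onI continuous_aff_param)

lemma space_induced_lebesgue: "space (induced_lebesgue \<alpha> A) = aff_subspace \<alpha> A"
  by (simp add: induced_lebesgue_def space_scale_measure space_restrict_space)

lemma emeasure_induced_lebesgue:
  assumes "B \<in> sets borel" "B \<subseteq> aff_subspace \<alpha> A"
  shows "emeasure (induced_lebesgue \<alpha> A) B =
    ennreal (gram_factor A) * emeasure lborel (aff_param \<alpha> A -` B)"
proof -
  have "B \<in> sets (restrict_space borel (aff_subspace \<alpha> A))"
    using assms by (auto simp: sets_restrict_space)
  then show ?thesis
    by (simp add: induced_lebesgue_def emeasure_distr[OF measurable_aff_param])
qed

lemma gram_factor_pos: "gram_factor A > 0"
proof -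
  define G where "G t = mat 1 + t *\<^sub>R (A ** transpose A)" for t :: real
  have nz: "det (G t) \<noteq> 0" if t: "t \<ge> 0" for t
  proof -
    have "x = 0" if x: "G t *v x = 0" for x
    proof -
      have "x \<bullet> (A *v (transpose A *v x)) = (transpose A *v x) \<bullet> (transpose A *v x)"
        by (simp add: dot_lmul_matrix[symmetric])
      moreover have "G t *v x = x + t *\<^sub>R (A *v (transpose A *v x))"
        unfolding G_def matrix_vector_mult_add_rdistrib matrix_vector_mul_assoc
        by (simp add: scaleR_matrix_vector_assoc del: transpose_matrix_vector)
      ultimately have "x \<bullet> x + t * ((transpose A *v x) \<bullet> (transpose A *v x)) = 0"
        using x by (metis inner_add_right inner_scaleR_right inner_zero_right)
      then have "x \<bullet> x \<le> 0"
        using t by (smt (verit) inner_ge_zero mult_nonneg_nonneg)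
      then show "x = 0"
        by (metis inner_gt_zero_iff not_le)
    qed
    then show ?thesis
      unfolding invertible_det_nz[symmetric] invertible_left_inverse matrix_left_invertible_ker
      by simp
  qed
  have cont: "continuous_on {0..1} (\<lambda>t. det (G t))"
    unfolding det_def G_def by (auto intro!: continuous_intros)
  have "det (G 1) > 0"
  proof (rule ccontr)
    assume "\<not> det (G 1) > 0"
    then have "\<exists>t\<ge>0. t \<le> 1 \<and> det (G t) = 0"
      using IVT2'[of "\<lambda>t. det (G t)" 1 0 0] cont by (auto simp: G_def)
    then show False
      using nz by blast
  qed
  then show ?thesis
    by (simp add: gram_factor_def G_def)
qed

end

theory Submission
  imports Defs
begin

text \<open>Let \<open>m = n - d\<close>. If a point \<open>x\<close> of a bounded region satisfies \<open>\<parallel>q (x, \<alpha> + x A)\<parallel> < \<psi>(q)\<close>, then \<open>x\<close>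
  is within \<open>\<psi>(q)/q\<close> of some \<open>a/q\<close> with \<open>\<parallel>q \<alpha> + a A\<parallel> \<lless> \<psi>(q)\<close>, so everything rests on counting
  integer points \<open>b\<close> in a box of side \<open>N\<close> in \<open>\<int>\<^sup>l\<close> with \<open>\<parallel>\<beta> + b M\<parallel> < \<delta>\<close>. Majorizing the indicator of
  \<open>\<parallel>y\<parallel> < \<delta>\<close> by \<open>4\<^sup>m J\<^bsup>-2m\<^esup> \<bar>\<Sum>h\<in>[0,J)\<^sup>m. e(h\<cdot>y)\<bar>\<^sup>2\<close> with \<open>J \<approx> 1/(6\<delta>)\<close>, the count is
  \<open>\<lless> \<delta>\<^sup>m (N\<^sup>l + S\<^sub>J)\<close>, where \<open>S\<^sub>J\<close> sums \<open>\<Prod>u. \<parallel>j\<cdot>row\<^sub>u M\<parallel>\<^bsup>-1\<^esup>\<close> over \<open>0 < \<bar>j\<bar> < J\<close>. The Diophantine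
  type bounds the product from below not only at each \<open>j\<close> but also at differences, so the points
  \<open>j M\<^sup>T mod 1\<close> are multiplicatively spaced and a dyadic decomposition yields
  \<open>S\<^sub>J \<lless> J\<^bsup>\<omega>+\<epsilon>\<^esup>\<close>. Since \<open>\<psi>\<close> may be enlarged to at least \<open>q\<^bsup>-\<tau>\<^esup>\<close> with some \<open>\<tau> > 1/n\<close>, the hypothesis
  \<open>\<omega> < l n\<close> makes \<open>S\<^sub>J\<close> negligible, and Borel--Cantelli applies: with \<open>M = A\<close> for each \<open>q\<close> separately
  in the strong case, and with \<open>M\<close> the matrix \<open>A\<close> extended by the row \<open>\<alpha>\<close> and dyadic blocks of \<open>q\<close>
  (Cauchy condensation) in the monotone case.\<close>

subsection \<open>Distance to the nearest integer\<close>

lemma dist_int_nonneg: "dist_int y \<ge> 0"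
  by (simp add: dist_int_def)

lemma dist_int_le_half: "dist_int y \<le> 1 / 2"
  unfolding dist_int_def using of_int_round_abs_le[of y] by (simp add: abs_minus_commute)

lemma dist_int_le: "dist_int y \<le> \<bar>y - of_int k\<bar>"
  unfolding dist_int_def by (rule round_diff_minimal)

lemma dist_int_add_le: "dist_int (x + y) \<le> dist_int x + \<bar>y\<bar>"
  using dist_int_le[of "x + y" "round x"] by (simp add: dist_int_def)

subsection \<open>Exponential sums\<close>

text \<open>Half of Jordan's inequality \<open>2 * x / pi \<le> sin x\<close>; the lost factor only
  affects constants. Up to \<open>pi / 3\<close> the mean value theorem applies with
  \<open>cos \<ge> 1 / 2\<close>; beyond, \<open>sin x\<close> is at least
  \<open>sin (pi / 6) = 1 / 2\<close>, while \<open>x / pi\<close> is at most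
  \<open>1 / 2\<close>.\<close>

lemma sin_ge_linear:
  fixes x :: real
  assumes "0 \<le> x" "x \<le> pi / 2"
  shows "sin x \<ge> x / pi"
proof (cases "x \<le> pi / 3")
  case True
  show ?thesis
  proof (cases "x = 0")
    case False
    then have "x > 0" using assms by simp
    then obtain z where z: "0 < z" "z < x" "sin x - sin 0 = (x - 0) * cos z"
      using MVT2[of 0 x sin cos] DERIV_sin by blast
    have "cos z \<ge> cos (pi / 3)"
      using z True by (intro cos_monotone_0_pi_le) auto
    then have "sin x \<ge> x * (1 / 2)"
      using z \<open>x > 0\<close> by (simp add: cos_60)
    moreover have "x / pi \<le> x * (1 / 2)"
      using \<open>x > 0\<close> pi_ge_two by (simp add: field_simps)
    ultimately show ?thesis by linarith
  qed simp
next
  case False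
  have "sin (pi / 6) \<le> sin x"
    using False assms by (intro sin_monotone_2pi_le) (auto simp: field_simps)
  moreover have "x / pi \<le> 1 / 2"
    using assms by (simp add: field_simps)
  ultimately show ?thesis by (metis order_trans sin_30)
qed

lemma cis_2pi_minus_round:
  "cis (2 * pi * y) = cis (2 * pi * (y - of_int (round y)))"
proof -
  have "cis (2 * pi * y) = cis (2 * pi * (y - of_int (round y))) * cis (2 * pi * of_int (round y))"
    by (simp add: cis_mult algebra_simps)
  then show ?thesis by simp
qed

text \<open>By periodicity \<open>y\<close> may be replaced by its signed distance \<open>t\<close>
  to the nearest integer, and the chord length is \<open>2 * sin (pi * \<bar>t\<bar>)\<close>. Since
  \<open>\<bar>t\<bar> \<le> 1 / 2\<close>, the linear bound for the sine applies.\<close>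

lemma norm_one_minus_cis_ge: "norm (1 - cis (2 * pi * y)) \<ge> 2 * dist_int y"
proof -
  define t where "t = y - of_int (round y)"
  have t: "\<bar>t\<bar> = dist_int y" by (simp add: t_def dist_int_def)
  have "\<bar>t\<bar> \<le> sin (pi * \<bar>t\<bar>)"
    using sin_ge_linear[of "pi * \<bar>t\<bar>"] dist_int_le_half[of y] t by simp
  moreover have "norm (1 - cis (2 * pi * t)) ^ 2 = (2 * sin (pi * \<bar>t\<bar>)) ^ 2"
  proof -
    have "norm (1 - cis (2 * pi * t)) ^ 2 = (1 - cos (2 * (pi * t)))\<^sup>2 + (sin (2 * (pi * t)))\<^sup>2"
      by (simp add: cmod_power2 mult.assoc)
    also have "\<dots> = 2 - 2 * cos (2 * (pi * t))"
      using sin_cos_squared_add[of "2 * (pi * t)"] by (simp add: power2_eq_square algebra_simps)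
    also have "\<dots> = (2 * sin (pi * t)) ^ 2"
      by (subst cos_double_sin) (simp add: power_mult_distrib)
    also have "\<dots> = (2 * sin (pi * \<bar>t\<bar>)) ^ 2"
      by (cases "t \<ge> 0") auto
    finally show ?thesis .
  qed
  ultimately have "norm (1 - cis (2 * pi * t)) = 2 * sin (pi * \<bar>t\<bar>)"
    using power2_eq_iff_nonneg[of "norm (1 - cis (2 * pi * t))" "2 * sin (pi * \<bar>t\<bar>)"]
      order_trans[of 0 "\<bar>t\<bar>" "sin (pi * \<bar>t\<bar>)"] by simp
  with \<open>\<bar>t\<bar> \<le> _\<close> show ?thesis
    using t cis_2pi_minus_round[of y] by (simp add: t_def)
qed

text \<open>A geometric series times a phase of modulus one from the shift \<open>a\<close>: the
  numerator has modulus at most 2, the denominator at least \<open>2 * dist_int y\<close>. The bound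
  is uniform in the length \<open>N\<close>.\<close>

lemma norm_sum_cis_le:
  fixes a :: int and N :: nat
  assumes "dist_int y > 0"
  shows "norm (\<Sum>b\<in>{a..<a + int N}. cis (2 * pi * (of_int b * y))) \<le> 1 / dist_int y"
proof -
  let ?z = "cis (2 * pi * y)"
  have img: "{a..<a + int N} = (\<lambda>i. a + int i) ` {..<N}"
  proof (intro equalityI subsetI)
    fix b assume "b \<in> {a..<a + int N}"
    then show "b \<in> (\<lambda>i. a + int i) ` {..<N}"
      by (intro image_eqI[of _ _ "nat (b - a)"]) auto
  qed auto
  have "norm (1 - ?z) \<ge> 2 * dist_int y" by (rule norm_one_minus_cis_ge)
  then have pos: "norm (1 - ?z) > 0" using assms by linarith
  have "(\<Sum>b\<in>{a..<a + int N}. cis (2 * pi * (of_int b * y)))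
      = (\<Sum>i<N. cis (2 * pi * (of_int (a + int i) * y)))"
    unfolding img by (subst sum.reindex) (auto simp: inj_on_def)
  also have "\<dots> = cis (2 * pi * (of_int a * y)) * (\<Sum>i<N. ?z ^ i)"
    unfolding sum_distrib_left
    unfolding Complex.DeMoivre cis_mult
    by (intro sum.cong refl arg_cong[where f = cis]) (simp add: algebra_simps)
  finally have "norm (\<Sum>b\<in>{a..<a + int N}. cis (2 * pi * (of_int b * y))) = norm (\<Sum>i<N. ?z ^ i)"
    by (simp add: norm_mult)
  also have "\<dots> = norm (1 - ?z ^ N) / norm (1 - ?z)"
    using pos by (simp add: sum_gp_strict norm_divide)
  also have "\<dots> \<le> 2 / norm (1 - ?z)"
    using pos norm_triangle_ineq4[of 1 "?z ^ N"] by (simp add: divide_right_mono norm_power)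
  also have "\<dots> \<le> 2 / (2 * dist_int y)"
    using \<open>norm (1 - ?z) \<ge> _\<close> assms pos by (intro divide_left_mono mult_pos_pos) auto
  finally show ?thesis by simp
qed

text \<open>When \<open>y\<close> is this close to an integer, every phase stays within
  \<open>pi / 3\<close> of zero modulo full turns. Each term then has real part at least 1/2, so
  there is no cancellation.\<close>

lemma norm_sum_cis_ge:
  fixes J :: nat
  assumes "6 * (real J * dist_int y) \<le> 1"
  shows "norm (\<Sum>h\<in>{0..<int J}. cis (2 * pi * (of_int h * y))) \<ge> real J / 2"
proof -
  define t where "t = y - of_int (round y)"
  have t: "\<bar>t\<bar> = dist_int y" by (simp add: t_def dist_int_def)
  have "1 / 2 \<le> Re (cis (2 * pi * (of_int h * y)))" if h: "h \<in> {0..<int J}" for h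
  proof -
    have "cis (2 * pi * (of_int h * y))
      = cis (2 * pi * (of_int h * t)) * cis (2 * pi * of_int (h * round y))"
      by (simp add: cis_mult t_def algebra_simps)
    also have "\<dots> = cis (2 * pi * (of_int h * t))" by (simp del: of_int_mult)
    finally have "Re (cis (2 * pi * (of_int h * y))) = cos (2 * pi * (of_int h * t))"
      by simp
    also have "\<dots> = cos \<bar>2 * pi * (of_int h * t)\<bar>" by simp
    also have "\<bar>2 * pi * (of_int h * t)\<bar> = 2 * pi * (of_int h * \<bar>t\<bar>)"
      using h by (simp add: abs_mult)
    finally have *: "Re (cis (2 * pi * (of_int h * y))) = cos (2 * pi * (of_int h * \<bar>t\<bar>))" .
    have "6 * (of_int h * \<bar>t\<bar>) \<le> 6 * (real J * \<bar>t\<bar>)"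
      using h by (intro mult_left_mono mult_right_mono) auto
    also have "6 * (real J * \<bar>t\<bar>) \<le> 1" using assms t by simp
    finally have "6 * (of_int h * \<bar>t\<bar>) \<le> 1" by simp
    then have "2 * pi * (of_int h * \<bar>t\<bar>) \<le> pi / 3" by simp
    then have "cos (2 * pi * (of_int h * \<bar>t\<bar>)) \<ge> cos (pi / 3)"
      using h by (intro cos_monotone_0_pi_le) auto
    then show ?thesis using * by (simp add: cos_60)
  qed
  then have "(\<Sum>h\<in>{0..<int J}. 1 / 2) \<le> (\<Sum>h\<in>{0..<int J}. Re (cis (2 * pi * (of_int h * y))))"
    by (rule sum_mono)
  also have "\<dots> = Re (\<Sum>h\<in>{0..<int J}. cis (2 * pi * (of_int h * y)))" by simp
  also have "\<dots> \<le> norm (\<Sum>h\<in>{0..<int J}. cis (2 * pi * (of_int h * y)))"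
    by (rule complex_Re_le_cmod)
  finally show ?thesis by simp
qed

section \<open>Counting points close to integers by squared exponential sums\<close>

lemma cis_sum: "finite S \<Longrightarrow> cis (\<Sum>x\<in>S. f x) = (\<Prod>x\<in>S. cis (f x))"
  by (induction S rule: finite_induct) (auto simp: cis_mult[symmetric])

lemma finite_bounded_int_functions: "finite {j :: 'm::finite \<Rightarrow> int. \<forall>k. \<bar>j k\<bar> < J}"
proof (rule finite_subset)
  show "{j :: 'm \<Rightarrow> int. \<forall>k. \<bar>j k\<bar> < J} \<subseteq> PiE UNIV (\<lambda>_. {- J..J})"
    by (auto simp: abs_less_iff) (smt (verit))+
qed (intro finite_PiE, auto)

text \<open>The squared modulus of the sum of \<open>e h b\<close> over \<open>h\<close> is a
  nonnegative majorant, up to scaling, of the indicator of the counted set. Expanding the square and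
  summing over \<open>b\<close> first leaves only differences \<open>j = h - h'\<close>: the zero
  difference gives the main term \<open>N ^ CARD('l)\<close>, the others products of geometric
  sums.\<close>

lemma card_close_points_le:
  fixes M :: "'l::finite \<Rightarrow> 'm::finite \<Rightarrow> real" and \<beta> :: "'m \<Rightarrow> real"
    and a :: "'l \<Rightarrow> int" and N J :: nat
  assumes J: "J \<ge> 1" "6 * (real J * \<delta>) \<le> 1"
    and pos: "\<And>j u. j \<noteq> (\<lambda>k. 0) \<Longrightarrow> (\<And>k. \<bar>j k\<bar> < int J) \<Longrightarrow>
      dist_int (\<Sum>k\<in>UNIV. of_int (j k) * M u k) > 0"
  shows "real (card {b \<in> PiE UNIV (\<lambda>u. {a u..<a u + int N}).
      \<forall>k. dist_int (\<beta> k + (\<Sum>u\<in>UNIV. of_int (b u) * M u k)) < \<delta>})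
    \<le> (4 / real J) ^ CARD('m) * (real N ^ CARD('l) +
      (\<Sum>j \<in> {j. \<forall>k. \<bar>j k\<bar> < int J} - {\<lambda>k. 0}.
         \<Prod>u\<in>UNIV. 1 / dist_int (\<Sum>k\<in>UNIV. of_int (j k) * M u k)))"
proof -
  define L where "L j u = (\<Sum>k\<in>UNIV. of_int (j k) * M u k)" for j :: "'m \<Rightarrow> int" and u
  define y where "y b k = \<beta> k + (\<Sum>u\<in>UNIV. of_int (b u) * M u k)" for b :: "'l \<Rightarrow> int" and k
  define B where "B = PiE (UNIV :: 'l set) (\<lambda>u. {a u..<a u + int N})"
  define H where "H = PiE (UNIV :: 'm set) (\<lambda>_. {0..<int J})"
  define G where "G = {b \<in> B. \<forall>k. dist_int (y b k) < \<delta>}"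
  define e where "e j b = cis (2 * pi * (\<Sum>k\<in>UNIV. of_int (j k) * y b k))"
    for j :: "'m \<Rightarrow> int" and b
  define R where "R = {j :: 'm \<Rightarrow> int. \<forall>k. \<bar>j k\<bar> < int J} - {\<lambda>k. 0}"
  define w where "w j = (\<Prod>u\<in>UNIV. 1 / dist_int (L j u))" for j
  have finB: "finite B" and finH: "finite H"
    unfolding B_def H_def by (auto intro: finite_PiE)
  have finR: "finite R" by (simp add: R_def finite_bounded_int_functions)
  have w_nonneg: "w j \<ge> 0" for j
    unfolding w_def by (intro prod_nonneg) (simp add: dist_int_nonneg)
  have cardH: "card H = J ^ CARD('m)"
    by (simp add: H_def card_PiE)
  \<comment> \<open>The sum over the box \<open>H\<close> factors into one sum per coordinate
    \<open>k\<close>, each without cancellation because \<open>y b k\<close> is close to an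
    integer.\<close>
  have lower: "(real J / 2) ^ CARD('m) \<le> norm (\<Sum>h\<in>H. e h b)" if "b \<in> G" for b
  proof -
    have "(\<Sum>h\<in>H. e h b) = (\<Sum>h\<in>H. \<Prod>k\<in>UNIV. cis (2 * pi * (of_int (h k) * y b k)))"
      by (simp add: e_def sum_distrib_left cis_sum)
    also have "\<dots> = (\<Prod>k\<in>UNIV. \<Sum>h\<in>{0..<int J}. cis (2 * pi * (of_int h * y b k)))"
      unfolding H_def by (subst prod_sum_PiE) auto
    finally have *: "norm (\<Sum>h\<in>H. e h b)
        = (\<Prod>k\<in>UNIV. norm (\<Sum>h\<in>{0..<int J}. cis (2 * pi * (of_int h * y b k))))"
      by (simp add: prod_norm)
    have "(\<Prod>k\<in>(UNIV :: 'm set). real J / 2)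
        \<le> (\<Prod>k\<in>UNIV. norm (\<Sum>h\<in>{0..<int J}. cis (2 * pi * (of_int h * y b k))))"
    proof (intro prod_mono conjI norm_sum_cis_ge)
      fix k
      have "dist_int (y b k) < \<delta>" using that by (simp add: G_def)
      then have "6 * (real J * dist_int (y b k)) \<le> 6 * (real J * \<delta>)"
        by (intro mult_left_mono) auto
      then show "6 * (real J * dist_int (y b k)) \<le> 1" using J by linarith
    qed simp
    then show ?thesis by (simp add: *)
  qed
  \<comment> \<open>The phase is affine in \<open>b\<close>: the part from \<open>\<beta>\<close>
    has modulus one and drops out, and the rest splits into one geometric sum per coordinate
    \<open>u\<close>.\<close>
  have norm_sum_e: "norm (\<Sum>b\<in>B. e j b)
      = (\<Prod>u\<in>UNIV. norm (\<Sum>b\<in>{a u..<a u + int N}. cis (2 * pi * (of_int b * L j u))))" for j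
  proof -
    have "(\<Sum>k\<in>UNIV. of_int (j k) * y b k)
        = (\<Sum>k\<in>UNIV. of_int (j k) * \<beta> k) + (\<Sum>u\<in>UNIV. of_int (b u) * L j u)" for b
    proof -
      have "(\<Sum>k\<in>UNIV. of_int (j k) * y b k) = (\<Sum>k\<in>UNIV. of_int (j k) * \<beta> k)
          + (\<Sum>k\<in>UNIV. \<Sum>u\<in>UNIV. of_int (j k) * (of_int (b u) * M u k))"
        by (simp add: y_def algebra_simps sum.distrib sum_distrib_left)
      also have "(\<Sum>k\<in>UNIV. \<Sum>u\<in>UNIV. of_int (j k) * (of_int (b u) * M u k))
          = (\<Sum>u\<in>UNIV. of_int (b u) * L j u)"
        unfolding L_def sum_distrib_left by (subst sum.swap) (simp add: algebra_simps)
      finally show ?thesis .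
    qed
    then have "e j b = cis (2 * pi * (\<Sum>k\<in>UNIV. of_int (j k) * \<beta> k)) *
        (\<Prod>u\<in>UNIV. cis (2 * pi * (of_int (b u) * L j u)))" for b
      unfolding e_def by (simp add: distrib_left cis_mult[symmetric] sum_distrib_left cis_sum)
    then have "(\<Sum>b\<in>B. e j b) = cis (2 * pi * (\<Sum>k\<in>UNIV. of_int (j k) * \<beta> k)) *
        (\<Sum>b\<in>B. \<Prod>u\<in>UNIV. cis (2 * pi * (of_int (b u) * L j u)))"
      by (simp add: sum_distrib_left)
    also have "(\<Sum>b\<in>B. \<Prod>u\<in>UNIV. cis (2 * pi * (of_int (b u) * L j u)))
        = (\<Prod>u\<in>UNIV. \<Sum>b\<in>{a u..<a u + int N}. cis (2 * pi * (of_int b * L j u)))"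
      unfolding B_def by (subst prod_sum_PiE) auto
    finally show ?thesis by (simp add: norm_mult prod_norm)
  qed
  have zero: "norm (\<Sum>b\<in>B. e (\<lambda>k. 0) b) \<le> real N ^ CARD('l)"
    by (simp add: norm_sum_e L_def)
  have nonzero: "norm (\<Sum>b\<in>B. e j b) \<le> w j" if "j \<in> R" for j
    unfolding norm_sum_e w_def
  proof (intro prod_mono conjI norm_sum_cis_le)
    show "dist_int (L j u) > 0" for u
      unfolding L_def using that by (intro pos) (auto simp: R_def)
  qed simp
  \<comment> \<open>For fixed \<open>h\<close> the map from \<open>h'\<close> to the difference is
    injective, so each nonzero \<open>j\<close> in \<open>R\<close> is hit at most once.\<close>
  have row: "(\<Sum>h'\<in>H. norm (\<Sum>b\<in>B. e (\<lambda>k. h k - h' k) b)) \<le> real N ^ CARD('l) + (\<Sum>j\<in>R. w j)"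
    if h: "h \<in> H" for h
  proof -
    have inj: "inj_on (\<lambda>h' k. h k - h' k) (H - {h})"
      by (auto simp: inj_on_def fun_eq_iff)
    have sub: "(\<lambda>h' k. h k - h' k) ` (H - {h}) \<subseteq> R"
    proof
      fix j assume "j \<in> (\<lambda>h' k. h k - h' k) ` (H - {h})"
      then obtain h' where h': "h' \<in> H" "h' \<noteq> h" "j = (\<lambda>k. h k - h' k)" by auto
      have "0 \<le> h k \<and> h k < int J \<and> 0 \<le> h' k \<and> h' k < int J" for k
        using h h' by (auto simp: H_def PiE_def Pi_def)
      then have "\<bar>j k\<bar> < int J" for k using h'(3) by (smt (verit))
      moreover from h'(2) obtain k where "h k \<noteq> h' k" by (metis ext)
      then have "j \<noteq> (\<lambda>k. 0)" using h'(3) by (auto simp: fun_eq_iff)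
      ultimately show "j \<in> R" by (auto simp: R_def)
    qed
    have "(\<Sum>h'\<in>H. norm (\<Sum>b\<in>B. e (\<lambda>k. h k - h' k) b))
        = norm (\<Sum>b\<in>B. e (\<lambda>k. 0) b) + (\<Sum>h'\<in>H - {h}. norm (\<Sum>b\<in>B. e (\<lambda>k. h k - h' k) b))"
      by (subst sum.remove[OF finH h]) simp
    also have "(\<Sum>h'\<in>H - {h}. norm (\<Sum>b\<in>B. e (\<lambda>k. h k - h' k) b))
        = (\<Sum>j\<in>(\<lambda>h' k. h k - h' k) ` (H - {h}). norm (\<Sum>b\<in>B. e j b))"
      by (subst sum.reindex[OF inj]) simp
    also have "\<dots> \<le> (\<Sum>j\<in>(\<lambda>h' k. h k - h' k) ` (H - {h}). w j)"
      using sub by (intro sum_mono nonzero) auto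
    also have "\<dots> \<le> (\<Sum>j\<in>R. w j)"
      by (intro sum_mono2 finR sub w_nonneg)
    finally show ?thesis using zero by simp
  qed
  have square: "complex_of_real ((norm (\<Sum>h\<in>H. e h b))\<^sup>2) = (\<Sum>h\<in>H. \<Sum>h'\<in>H. e (\<lambda>k. h k - h' k) b)" for b
  proof -
    have "e h b * cnj (e h' b) = e (\<lambda>k. h k - h' k) b" for h h'
      by (simp add: e_def cis_cnj cis_mult algebra_simps sum_subtractf)
    then show ?thesis
      by (simp only: complex_norm_square cnj_sum sum_product)
  qed
  have "real (card G) * ((real J / 2) ^ CARD('m))\<^sup>2 = (\<Sum>b\<in>G. ((real J / 2) ^ CARD('m))\<^sup>2)"
    by simp
  also have "\<dots> \<le> (\<Sum>b\<in>G. (norm (\<Sum>h\<in>H. e h b))\<^sup>2)"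
    by (intro sum_mono power_mono lower) auto
  also have "\<dots> \<le> (\<Sum>b\<in>B. (norm (\<Sum>h\<in>H. e h b))\<^sup>2)"
    by (intro sum_mono2 finB) (auto simp: G_def)
  also have "\<dots> = norm (complex_of_real (\<Sum>b\<in>B. (norm (\<Sum>h\<in>H. e h b))\<^sup>2))"
    by (subst norm_of_real, subst abs_of_nonneg) (auto intro: sum_nonneg)
  also have "complex_of_real (\<Sum>b\<in>B. (norm (\<Sum>h\<in>H. e h b))\<^sup>2)
      = (\<Sum>b\<in>B. \<Sum>h\<in>H. \<Sum>h'\<in>H. e (\<lambda>k. h k - h' k) b)"
    by (simp add: square[symmetric])
  also have "\<dots> = (\<Sum>h\<in>H. \<Sum>h'\<in>H. \<Sum>b\<in>B. e (\<lambda>k. h k - h' k) b)"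
    by (subst sum.swap, rule sum.cong[OF refl], rule sum.swap)
  also have "norm \<dots> \<le> (\<Sum>h\<in>H. \<Sum>h'\<in>H. norm (\<Sum>b\<in>B. e (\<lambda>k. h k - h' k) b))"
    by (intro sum_norm_le order_refl)
  also have "\<dots> \<le> (\<Sum>h\<in>H. real N ^ CARD('l) + (\<Sum>j\<in>R. w j))"
    by (intro sum_mono row)
  also have "\<dots> = real J ^ CARD('m) * (real N ^ CARD('l) + (\<Sum>j\<in>R. w j))"
    by (simp add: cardH)
  finally have "real (card G) * ((real J / 2) ^ CARD('m))\<^sup>2
      \<le> real J ^ CARD('m) * (real N ^ CARD('l) + (\<Sum>j\<in>R. w j))" .
  \<comment> \<open>One factor \<open>J ^ CARD('m)\<close> is split off to cancel the number of
    choices of \<open>h\<close>; what remains explains the constant \<open>4 / J\<close>.\<close>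
  moreover have "((real J / 2) ^ CARD('m))\<^sup>2 = real J ^ CARD('m) * (real J / 4) ^ CARD('m)"
  proof -
    have "real J / 2 * (real J / 2) = real J * (real J / 4)" by simp
    then show ?thesis unfolding power2_eq_square power_mult_distrib[symmetric] by (rule arg_cong)
  qed
  ultimately have "real J ^ CARD('m) * (real (card G) * (real J / 4) ^ CARD('m))
      \<le> real J ^ CARD('m) * (real N ^ CARD('l) + (\<Sum>j\<in>R. w j))"
    by (simp add: mult_ac)
  then have "real (card G) * (real J / 4) ^ CARD('m) \<le> real N ^ CARD('l) + (\<Sum>j\<in>R. w j)"
    using J by simp
  then have "real (card G) \<le> (4 / real J) ^ CARD('m) * (real N ^ CARD('l) + (\<Sum>j\<in>R. w j))"
    using J by (simp add: power_divide pos_le_divide_eq pos_divide_le_eq mult.commute)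
  then show ?thesis
    by (simp only: G_def R_def w_def L_def B_def y_def)
qed

subsection \<open>Sums over multiplicatively spaced points\<close>

lemma dyadic_exponent_bounds:
  fixes x :: real
  assumes "0 < x" "x \<le> 1"
  defines "e \<equiv> nat \<lceil>log 2 (1 / x)\<rceil>"
  shows "1 \<le> x * 2 ^ e" "x * 2 ^ e < 2" "real e < log 2 (1 / x) + 1"
proof -
  have l0: "log 2 (1 / x) \<ge> 0" using assms by simp
  then have e: "log 2 (1 / x) \<le> real e" "real e < log 2 (1 / x) + 1"
    unfolding e_def by linarith+
  then show "real e < log 2 (1 / x) + 1" by simp
  have p: "2 powr log 2 (1 / x) = 1 / x" using assms by simp
  have "1 / x \<le> 2 powr real e"
    using e by (subst p[symmetric]) (intro powr_mono, auto)
  then show "1 \<le> x * 2 ^ e" using assms(1) by (simp add: powr_realpow field_simps)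
  have "2 powr real e < 2 powr (log 2 (1 / x) + 1)"
    using e by (intro powr_less_mono) auto
  also have "\<dots> = 1 / x * 2" by (simp add: powr_add p del: powr_log_cancel)
  finally show "x * 2 ^ e < 2" using assms(1) by (simp add: powr_realpow field_simps)
qed

text \<open>A pigeonhole argument in a box of volume \<open>\<Prod>u. 1 / 2 ^ e u\<close>. Fixing
  the signs \<open>s\<close> confines the points to one orthant, so that differences are bounded by
  the sides of the box. The separation is a product, so subdividing a single side is enough.\<close>

lemma card_dyadic_class_le:
  fixes f :: "'j \<Rightarrow> 'l::finite \<Rightarrow> real" and e :: "'l \<Rightarrow> nat" and s :: "'l \<Rightarrow> bool"
  assumes "\<kappa> > 0"
    and dy: "\<And>j u. j \<in> P \<Longrightarrow> 1 \<le> \<bar>f j u\<bar> * 2 ^ e u \<and> \<bar>f j u\<bar> * 2 ^ e u < 2 \<and> (f j u > 0 \<longleftrightarrow> s u)"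
    and sep: "\<And>i j. i \<in> P \<Longrightarrow> j \<in> P \<Longrightarrow> i \<noteq> j \<Longrightarrow> \<kappa> \<le> (\<Prod>u\<in>UNIV. \<bar>f i u - f j u\<bar>)"
  shows "finite P \<and> real (card P) \<le> (\<Prod>u\<in>UNIV. 1 / 2 ^ e u) / \<kappa> + 1"
proof -
  define V where "V = (\<Prod>u\<in>(UNIV :: 'l set). 1 / 2 ^ e u :: real)"
  have Vpos: "V > 0" unfolding V_def by (intro prod_pos) auto
  define p where "p = nat \<lfloor>V / \<kappa>\<rfloor> + 1"
  have p: "real p > V / \<kappa>" "real p \<le> V / \<kappa> + 1"
    using Vpos \<open>\<kappa> > 0\<close> unfolding p_def by (auto simp: of_nat_nat) linarith+
  obtain u0 :: 'l where True by simp
  \<comment> \<open>Cutting one side of the dyadic box into \<open>p\<close> pieces gives boxes of volume \<open>V / p < \<kappa>\<close>,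
    each of which contains at most one point.\<close>
  define g where "g j = \<lfloor>real p * (\<bar>f j u0\<bar> * 2 ^ e u0)\<rfloor>" for j
  have diff: "\<bar>f i u - f j u\<bar> = \<bar>\<bar>f i u\<bar> - \<bar>f j u\<bar>\<bar>" if "i \<in> P" "j \<in> P" for i j u
    using dy[OF that(1), of u] dy[OF that(2), of u] by (cases "s u") auto
  have "inj_on g P"
  proof (rule inj_onI, rule ccontr)
    fix i j assume ij: "i \<in> P" "j \<in> P" "g i = g j" "i \<noteq> j"
    have le: "\<bar>f i u - f j u\<bar> \<le> 1 / 2 ^ e u" for u
    proof -
      have "\<bar>\<bar>f i u\<bar> * 2 ^ e u - \<bar>f j u\<bar> * 2 ^ e u\<bar> \<le> 1"
        using dy[OF ij(1), of u] dy[OF ij(2), of u] by linarith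
      then have "\<bar>f i u - f j u\<bar> * 2 ^ e u \<le> 1"
        unfolding diff[OF ij(1,2)] by (simp add: left_diff_distrib[symmetric] abs_mult)
      then show ?thesis by (simp add: field_simps)
    qed
    have "\<bar>real p * (\<bar>f i u0\<bar> * 2 ^ e u0) - real p * (\<bar>f j u0\<bar> * 2 ^ e u0)\<bar> \<le> 1"
      using ij(3) unfolding g_def by linarith
    then have "real p * (\<bar>f i u0 - f j u0\<bar> * 2 ^ e u0) \<le> 1"
      unfolding diff[OF ij(1,2)] by (simp add: left_diff_distrib[symmetric] right_diff_distrib[symmetric] abs_mult)
    moreover have "real p > 0" by (simp add: p_def)
    ultimately have u0: "\<bar>f i u0 - f j u0\<bar> \<le> 1 / 2 ^ e u0 / real p"
      by (simp add: field_simps)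
    have "\<kappa> \<le> (\<Prod>u\<in>UNIV. \<bar>f i u - f j u\<bar>)" using ij by (intro sep)
    also have "\<dots> = \<bar>f i u0 - f j u0\<bar> * (\<Prod>u\<in>UNIV - {u0}. \<bar>f i u - f j u\<bar>)"
      by (intro prod.remove) auto
    also have "\<dots> \<le> 1 / 2 ^ e u0 / real p * (\<Prod>u\<in>UNIV - {u0}. 1 / 2 ^ e u)"
      by (intro mult_mono u0 prod_mono conjI le prod_nonneg) auto
    also have "\<dots> = V / real p"
      unfolding V_def by (subst prod.remove[of UNIV u0]) auto
    also have "\<dots> < \<kappa>" using p \<open>\<kappa> > 0\<close> \<open>real p > 0\<close> by (simp add: field_simps)
    finally show False by simp
  qed
  \<comment> \<open>The rescaled coordinate lies in \<open>[1, 2)\<close>, which leaves exactly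
    \<open>p\<close> possible values of \<open>g\<close>.\<close>
  moreover have "g ` P \<subseteq> {int p..<2 * int p}"
  proof
    fix x assume "x \<in> g ` P"
    then obtain j where j: "j \<in> P" "x = g j" by auto
    have "real p * 1 \<le> real p * (\<bar>f j u0\<bar> * 2 ^ e u0)"
      using dy[OF j(1), of u0] by (intro mult_left_mono) auto
    moreover have "real p * (\<bar>f j u0\<bar> * 2 ^ e u0) < real p * 2"
      using dy[OF j(1), of u0] by (intro mult_strict_left_mono) (auto simp: p_def)
    ultimately show "x \<in> {int p..<2 * int p}"
      using dy[OF j(1), of u0] unfolding j g_def by (auto simp: le_floor_iff floor_less_iff)
  qed
  ultimately have "finite P \<and> card P \<le> card {int p..<2 * int p}"
    using inj_on_finite[of g P "{int p..<2 * int p}"] card_inj_on_le[of g P "{int p..<2 * int p}"]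
    by auto
  then show ?thesis using p(2) by (auto simp: V_def)
qed

text \<open>The points are sorted by dyadic sizes and signs of their coordinates. A class with box
  volume \<open>V\<close> has at most \<open>V / \<kappa> + 1\<close> members, each contributing at
  most \<open>1 / V\<close>, and the number of classes is only a power of a logarithm.\<close>

lemma sum_inverse_prod_spaced_le:
  fixes f :: "'j \<Rightarrow> 'l::finite \<Rightarrow> real"
  assumes "finite P" and "0 < \<kappa>" "\<kappa> \<le> 1"
    and le1: "\<And>j u. j \<in> P \<Longrightarrow> \<bar>f j u\<bar> \<le> 1"
    and ge: "\<And>j. j \<in> P \<Longrightarrow> \<kappa> \<le> (\<Prod>u\<in>UNIV. \<bar>f j u\<bar>)"
    and sep: "\<And>i j. i \<in> P \<Longrightarrow> j \<in> P \<Longrightarrow> i \<noteq> j \<Longrightarrow> \<kappa> \<le> (\<Prod>u\<in>UNIV. \<bar>f i u - f j u\<bar>)"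
  shows "(\<Sum>j\<in>P. \<Prod>u\<in>UNIV. 1 / \<bar>f j u\<bar>)
    \<le> (2 * (log 2 (1 / \<kappa>) + 2)) ^ CARD('l) * ((2 ^ CARD('l) + 1) / \<kappa>)"
proof -
  define e where "e j u = nat \<lceil>log 2 (1 / \<bar>f j u\<bar>)\<rceil>" for j u
  define c where "c j = (\<lambda>u. (e j u, f j u > 0))" for j
  define E where "E = nat \<lfloor>log 2 (1 / \<kappa>)\<rfloor> + 1"
  define T where "T = PiE (UNIV :: 'l set) (\<lambda>_. {0..E} \<times> (UNIV :: bool set))"
  have l0: "log 2 (1 / \<kappa>) \<ge> 0" using assms by simp
  \<comment> \<open>All factors are at most 1, so the lower bound for the product passes to each
    factor and bounds the dyadic exponents by \<open>E\<close>.\<close>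
  have ge1: "\<kappa> \<le> \<bar>f j u\<bar>" if "j \<in> P" for j u
  proof -
    have "\<kappa> \<le> \<bar>f j u\<bar> * (\<Prod>u\<in>UNIV - {u}. \<bar>f j u\<bar>)"
      using ge[OF that] by (subst (asm) prod.remove[of UNIV u]) auto
    also have "\<dots> \<le> \<bar>f j u\<bar> * 1"
      using le1[OF that] by (intro mult_left_mono prod_le_1) auto
    finally show ?thesis by simp
  qed
  have dy: "1 \<le> \<bar>f j u\<bar> * 2 ^ e j u \<and> \<bar>f j u\<bar> * 2 ^ e j u < 2" and eE: "e j u \<le> E" if "j \<in> P" for j u
  proof -
    have pos: "\<bar>f j u\<bar> > 0" using ge1[OF that, of u] assms(2) by linarith
    then show "1 \<le> \<bar>f j u\<bar> * 2 ^ e j u \<and> \<bar>f j u\<bar> * 2 ^ e j u < 2"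
      using dyadic_exponent_bounds(1,2)[OF pos le1[OF that]] by (simp add: e_def)
    have "log 2 (1 / \<bar>f j u\<bar>) \<le> log 2 (1 / \<kappa>)"
      using ge1[OF that, of u] pos assms(2) by (intro log_mono) (auto intro!: divide_left_mono)
    then have "real (e j u) < log 2 (1 / \<kappa>) + 1"
      using dyadic_exponent_bounds(3)[OF pos le1[OF that]] by (simp add: e_def)
    then show "e j u \<le> E" using l0 unfolding E_def by linarith
  qed
  have finT: "finite T" unfolding T_def by (auto intro: finite_PiE)
  have "real (card T) = (2 * (real E + 1)) ^ CARD('l)"
    by (simp add: T_def card_PiE card_cartesian_product algebra_simps)
  also have "\<dots> \<le> (2 * (log 2 (1 / \<kappa>) + 2)) ^ CARD('l)"
    using l0 unfolding E_def by (intro power_mono) (simp_all add: of_nat_nat)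
  finally have cardT: "real (card T) \<le> (2 * (log 2 (1 / \<kappa>) + 2)) ^ CARD('l)" .
  have cls: "(\<Sum>j\<in>{j\<in>P. c j = t}. \<Prod>u\<in>UNIV. 1 / \<bar>f j u\<bar>) \<le> (2 ^ CARD('l) + 1) / \<kappa>" for t
  proof (cases "{j\<in>P. c j = t} = {}")
    case False
    define V where "V = (\<Prod>u\<in>(UNIV :: 'l set). 1 / 2 ^ fst (t u) :: real)"
    have Vpos: "V > 0" unfolding V_def by (intro prod_pos) auto
    have et: "e j u = fst (t u)" "(f j u > 0) = snd (t u)" if "j \<in> {j\<in>P. c j = t}" for j u
      using that by (auto simp: c_def)
    have card: "real (card {j\<in>P. c j = t}) \<le> V / \<kappa> + 1"
      using card_dyadic_class_le[of \<kappa> "{j\<in>P. c j = t}" f "\<lambda>u. fst (t u)" "\<lambda>u. snd (t u)"]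
        dy et sep assms(2) unfolding V_def by fastforce
    obtain i where i: "i \<in> P" "c i = t" using False by auto
    \<comment> \<open>A member \<open>i\<close> of the class forces
      \<open>\<kappa> \<le> 2 ^ CARD('l) * V\<close>; this absorbs the summand 1 of the cardinality
      bound.\<close>
    have "\<kappa> \<le> (\<Prod>u\<in>UNIV. \<bar>f i u\<bar>)" using ge i by auto
    also have "\<dots> \<le> (\<Prod>u\<in>(UNIV :: 'l set). 2 * (1 / 2 ^ fst (t u)))"
      using dy[OF i(1)] et(1)[of i] i by (intro prod_mono) (auto simp: field_simps less_imp_le)
    also have "\<dots> = 2 ^ CARD('l) * V" unfolding V_def prod.distrib by simp
    finally have "1 \<le> 2 ^ CARD('l) * V / \<kappa>" using assms(2) by simp
    with card have card': "real (card {j\<in>P. c j = t}) \<le> (2 ^ CARD('l) + 1) * V / \<kappa>"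
      by (simp add: distrib_right add_divide_distrib)
    have "(\<Sum>j\<in>{j\<in>P. c j = t}. \<Prod>u\<in>UNIV. 1 / \<bar>f j u\<bar>) \<le> (\<Sum>j\<in>{j\<in>P. c j = t}. 1 / V)"
    proof (rule sum_mono)
      fix j assume j: "j \<in> {j\<in>P. c j = t}"
      have "(\<Prod>u\<in>UNIV. 1 / \<bar>f j u\<bar>) \<le> (\<Prod>u\<in>UNIV. 2 ^ fst (t u))"
      proof (intro prod_mono conjI)
        fix u
        have "\<bar>f j u\<bar> > 0" using ge1[of j u] j assms(2) by auto
        then show "1 / \<bar>f j u\<bar> \<le> 2 ^ fst (t u)"
          using dy[of j u] et(1)[OF j, of u] j by (simp add: field_simps)
      qed simp
      also have "\<dots> = 1 / V" by (simp add: V_def prod_dividef)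
      finally show "(\<Prod>u\<in>UNIV. 1 / \<bar>f j u\<bar>) \<le> 1 / V" .
    qed
    also have "\<dots> = real (card {j\<in>P. c j = t}) / V" by simp
    also have "\<dots> \<le> (2 ^ CARD('l) + 1) * V / \<kappa> / V"
      using card' Vpos by (intro divide_right_mono) auto
    finally show ?thesis using Vpos by simp
  next
    case True
    then show ?thesis using assms(2) by (simp only:) simp
  qed
  have "(\<Sum>j\<in>P. \<Prod>u\<in>UNIV. 1 / \<bar>f j u\<bar>)
      = (\<Sum>t\<in>T. \<Sum>j\<in>{j\<in>P. c j = t}. \<Prod>u\<in>UNIV. 1 / \<bar>f j u\<bar>)"
    using eE by (intro sum.group[symmetric] assms(1) finT) (auto simp: T_def c_def)
  also have "\<dots> \<le> (\<Sum>t\<in>T. (2 ^ CARD('l) + 1) / \<kappa>)" by (intro sum_mono cls)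
  also have "\<dots> = real (card T) * ((2 ^ CARD('l) + 1) / \<kappa>)" by simp
  also have "\<dots> \<le> (2 * (log 2 (1 / \<kappa>) + 2)) ^ CARD('l) * ((2 ^ CARD('l) + 1) / \<kappa>)"
    using assms(2) by (intro mult_right_mono cardT) auto
  finally show ?thesis .
qed

subsection \<open>Counting integer points with a Diophantine condition\<close>

lemma real_vec_inner_row:
  "real_vec j \<bullet> row u M = (\<Sum>k\<in>UNIV. of_int (j $ k) * M $ u $ k)"
  by (simp add: inner_vec_def real_vec_def row_def)

lemma dist_int_mult_int_eq_0:
  assumes "dist_int x = 0"
  shows "dist_int (of_int k * x) = 0"
proof -
  have "x = of_int (round x)" using assms by (simp add: dist_int_def)
  then have "dist_int (of_int k * x) \<le> 0"
    using dist_int_le[of "of_int k * x" "k * round x"] by simp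
  then show ?thesis using dist_int_nonneg[of "of_int k * x"] by simp
qed

text \<open>For an exponent \<open>\<omega>\<close> strictly between the type and \<open>X\<close>,
  only finitely many vectors violate the inequality with constant 1, and shrinking the constant to
  \<open>c\<close> covers them. The form with \<open>K\<close> in place of the norm makes it
  applicable to whole boxes of vectors.\<close>

lemma dioph_type_lower_bound:
  fixes M :: "real ^ 'm ^ 'l"
  assumes "dioph_type M < ereal X" "X > 0"
  obtains \<omega> c where "0 < \<omega>" "\<omega> < X" "0 < c" "c \<le> 1"
    "\<And>(j :: 'm \<Rightarrow> int) K. j \<noteq> (\<lambda>k. 0) \<Longrightarrow> (\<And>k. real_of_int \<bar>j k\<bar> \<le> K) \<Longrightarrow>
      c * K powr (- \<omega>) \<le> (\<Prod>u\<in>UNIV. dist_int (\<Sum>k\<in>UNIV. of_int (j k) * M $ u $ k))"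
proof -
  \<comment> \<open>The maximum with 0 makes \<open>\<omega>\<close> positive, so that
    \<open>K powr (- \<omega>)\<close> decreases in \<open>K\<close>.\<close>
  have "max (dioph_type M) 0 < ereal X" using assms by simp
  then obtain \<omega> where \<omega>: "max (dioph_type M) 0 < ereal \<omega>" "ereal \<omega> < ereal X"
    using ereal_dense2 by blast
  define p where "p j = (\<Prod>u\<in>UNIV. dist_int (real_vec j \<bullet> row u M))" for j :: "int ^ 'm"
  define F where "F = {j. p j < infnorm (real_vec j) powr (- \<omega>)}"
  have finF: "finite F"
  proof (rule ccontr)
    assume "infinite F"
    then have "ereal \<omega> \<le> dioph_type M"
      unfolding dioph_type_def by (intro Sup_upper) (auto simp: F_def p_def)
    then show False using \<omega>(1) by (metis leD max_less_iff_conj)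
  qed
  have pos: "infnorm (real_vec j) > 0" if "j \<noteq> 0" for j :: "int ^ 'm"
    using that by (simp add: infnorm_pos_lt vec_eq_iff real_vec_def)
  have p0: "p j \<ge> 0" for j unfolding p_def by (intro prod_nonneg) (simp add: dist_int_nonneg)
  have ppos: "p j > 0" if j: "j \<noteq> 0" for j
  proof (rule ccontr)
    assume "\<not> p j > 0"
    then have "p j = 0" using p0[of j] by simp
    \<comment> \<open>All multiples of \<open>j\<close> would be exceptions as well.\<close>
    then obtain u where u: "dist_int (real_vec j \<bullet> row u M) = 0" by (auto simp: p_def)
    define g where "g i = (\<chi> k. int (Suc i) * j $ k)" for i
    obtain k where k: "j $ k \<noteq> 0" using j by (auto simp: vec_eq_iff)
    have "inj g"
    proof (rule injI)
      fix a b assume "g a = g b"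
      then have "g a $ k = g b $ k" by simp
      then show "a = b" using k by (simp add: g_def)
    qed
    moreover have "range g \<subseteq> F"
    proof
      fix x assume "x \<in> range g"
      then obtain i where i: "x = g i" by auto
      have "real_vec x \<bullet> row u M = of_int (int (Suc i)) * (real_vec j \<bullet> row u M)"
        unfolding real_vec_inner_row sum_distrib_left i g_def by (simp add: mult.assoc)
      then have "dist_int (real_vec x \<bullet> row u M) = 0"
        using dist_int_mult_int_eq_0[OF u] by metis
      then have "p x = 0" by (auto simp: p_def)
      moreover have "x $ k \<noteq> 0" using k by (simp add: i g_def)
      then have "x \<noteq> 0" by (metis zero_index)
      ultimately show "x \<in> F" using pos[of x] by (simp add: F_def)
    qed
    ultimately show False using finF
      by (meson finite_subset infinite_UNIV_nat finite_imageD)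
  qed
  define c where "c = Min (insert 1 ((\<lambda>j. p j * infnorm (real_vec j) powr \<omega>) ` F))"
  have c1: "c \<le> 1" unfolding c_def using finF by (intro Min_le) auto
  \<comment> \<open>By the convention \<open>0 powr x = 0\<close>, the zero vector is not in
    \<open>F\<close>; hence all entries of the minimum \<open>c\<close> are positive.\<close>
  have nz: "j \<noteq> 0" if "j \<in> F" for j
    using that p0[of j] by (auto simp: F_def real_vec_def infnorm_0 zero_vec_def[symmetric])
  have cpos: "c > 0" unfolding c_def using finF ppos pos nz
    by (subst Min_gr_iff) (auto intro!: mult_pos_pos, force)
  have bound: "c * infnorm (real_vec j) powr (- \<omega>) \<le> p j" if j: "j \<noteq> 0" for j
  proof (cases "j \<in> F")
    case True
    then have "c \<le> p j * infnorm (real_vec j) powr \<omega>"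
      unfolding c_def using finF by (intro Min_le) auto
    then show ?thesis using pos[OF j] by (simp add: powr_minus field_simps)
  next
    case False
    then have "infnorm (real_vec j) powr (- \<omega>) \<le> p j" by (simp add: F_def)
    moreover have "c * infnorm (real_vec j) powr (- \<omega>) \<le> 1 * infnorm (real_vec j) powr (- \<omega>)"
      using c1 by (intro mult_right_mono) auto
    ultimately show ?thesis by simp
  qed
  show thesis
  proof (rule that[of \<omega> c])
    show "0 < \<omega>" "\<omega> < X" using \<omega> by auto
    fix j :: "'m \<Rightarrow> int" and K assume j: "j \<noteq> (\<lambda>k. 0)" and K: "\<And>k. real_of_int \<bar>j k\<bar> \<le> K"
    define v where "v = (\<chi> k. j k)"
    have v: "v \<noteq> 0" using j by (auto simp: v_def vec_eq_iff)
    have "infnorm (real_vec v) \<le> K"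
      unfolding infnorm_cart using K by (intro cSup_least) (auto simp: v_def real_vec_def)
    then have "K powr (- \<omega>) \<le> infnorm (real_vec v) powr (- \<omega>)"
      using pos[OF v] \<omega> by (intro powr_mono2') auto
    then have "c * K powr (- \<omega>) \<le> p v"
      using bound[OF v] cpos by (smt (verit) mult_left_mono)
    then show "c * K powr (- \<omega>) \<le> (\<Prod>u\<in>UNIV. dist_int (\<Sum>k\<in>UNIV. of_int (j k) * M $ u $ k))"
      by (simp add: p_def real_vec_inner_row v_def)
  qed (use c1 cpos in auto)
qed

section \<open>Reciprocal products of distances to integers, summed over a box\<close>

lemma log2_le_powr:
  fixes x \<epsilon> :: real
  assumes "x \<ge> 1" "\<epsilon> > 0"
  shows "log 2 x + 2 \<le> (1 / (\<epsilon> * ln 2) + 2) * x powr \<epsilon>"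
proof -
  have "log 2 x \<le> x powr \<epsilon> / \<epsilon> / ln 2"
    unfolding log_def using ln_powr_bound[OF assms] by (intro divide_right_mono) auto
  moreover have "1 \<le> x powr \<epsilon>" using assms by (simp add: ge_one_powr_ge_zero)
  ultimately show ?thesis by (simp add: field_simps)
qed

text \<open>The lower bound holds at each \<open>j\<close> and at differences of two of them, so the
  signed distances \<open>f j\<close> are multiplicatively spaced. Enlarging the exponent from
  \<open>\<omega>\<close> to \<open>\<omega>'\<close> pays for the logarithms.\<close>

lemma sum_inverse_dist_int_bound:
  fixes M :: "'l::finite \<Rightarrow> 'm::finite \<Rightarrow> real"
  assumes "0 < \<omega>" "\<omega> < \<omega>'" "0 < c" "c \<le> 1"
    and lower: "\<And>(j :: 'm \<Rightarrow> int) K. j \<noteq> (\<lambda>k. 0) \<Longrightarrow> (\<And>k. real_of_int \<bar>j k\<bar> \<le> K) \<Longrightarrow>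
      c * K powr (- \<omega>) \<le> (\<Prod>u\<in>UNIV. dist_int (\<Sum>k\<in>UNIV. of_int (j k) * M u k))"
  obtains C where "C > 0"
    "\<And>J :: nat. J \<ge> 1 \<Longrightarrow> (\<Sum>j \<in> {j. \<forall>k. \<bar>j k\<bar> < int J} - {\<lambda>k. 0}.
       \<Prod>u\<in>UNIV. 1 / dist_int (\<Sum>k\<in>UNIV. of_int (j k) * M u k)) \<le> C * real J powr \<omega>'"
proof -
  define l where "l = CARD('l)"
  have l: "l > 0" by (simp add: l_def)
  \<comment> \<open>The final bound is a multiple of \<open>(1 / \<kappa>) powr s\<close> with
    \<open>\<kappa>\<close> of order \<open>J powr (- \<omega>)\<close>, hence of order
    \<open>J powr \<omega>'\<close>. The excess \<open>s - 1\<close> is shared among the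
    \<open>l\<close> logarithmic factors, \<open>\<epsilon>\<close> for each.\<close>
  define s where "s = \<omega>' / \<omega>"
  have s: "s > 1" using assms by (simp add: s_def)
  define \<epsilon> where "\<epsilon> = (s - 1) / real l"
  have \<epsilon>: "\<epsilon> > 0" using s l by (simp add: \<epsilon>_def)
  define D where "D = 2 * (1 / (\<epsilon> * ln 2) + 2)"
  have D: "D > 0" unfolding D_def using \<epsilon> by (intro mult_pos_pos add_pos_pos) auto
  define C where "C = D ^ l * (2 ^ l + 1) * c powr (- s) * 2 powr \<omega>'"
  show thesis
  proof (rule that)
    show "C > 0" using D assms by (simp add: C_def add_pos_pos)
    fix J :: nat assume J: "J \<ge> 1"
    define R where "R = {j :: 'm \<Rightarrow> int. \<forall>k. \<bar>j k\<bar> < int J} - {\<lambda>k. 0}"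
    define L where "L j u = (\<Sum>k\<in>UNIV. of_int (j k) * M u k)" for j :: "'m \<Rightarrow> int" and u
    define f where "f j u = L j u - of_int (round (L j u))" for j u
    have absf: "\<bar>f j u\<bar> = dist_int (L j u)" for j u by (simp add: f_def dist_int_def)
    \<comment> \<open>The factor 2 accounts for differences of vectors with entries below
      \<open>J\<close>.\<close>
    define \<kappa> where "\<kappa> = c * (2 * real J) powr (- \<omega>)"
    have \<kappa>0: "\<kappa> > 0" using assms J by (simp add: \<kappa>_def)
    have "(2 * real J) powr (- \<omega>) \<le> 1"
      using assms J ge_one_powr_ge_zero[of "2 * real J" \<omega>] by (simp add: powr_minus inverse_le_1_iff)
    then have \<kappa>1: "\<kappa> \<le> 1" unfolding \<kappa>_def using assms by (intro mult_le_one) auto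
    have finR: "finite R" by (simp add: R_def finite_bounded_int_functions)
    have "(\<Sum>j\<in>R. \<Prod>u\<in>UNIV. 1 / \<bar>f j u\<bar>)
        \<le> (2 * (log 2 (1 / \<kappa>) + 2)) ^ CARD('l) * ((2 ^ CARD('l) + 1) / \<kappa>)"
    proof (rule sum_inverse_prod_spaced_le[OF finR \<kappa>0 \<kappa>1])
      show "\<bar>f j u\<bar> \<le> 1" for j u unfolding absf using dist_int_le_half[of "L j u"] by linarith
      show "\<kappa> \<le> (\<Prod>u\<in>UNIV. \<bar>f j u\<bar>)" if "j \<in> R" for j
      proof -
        have jk: "\<bar>j k\<bar> < int J" for k using that by (auto simp: R_def)
        have "real_of_int \<bar>j k\<bar> \<le> 2 * real J" for k
          using jk[of k] by linarith
        then show ?thesis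
          unfolding \<kappa>_def absf L_def using that by (intro lower) (auto simp: R_def)
      qed
      show "\<kappa> \<le> (\<Prod>u\<in>UNIV. \<bar>f i u - f j u\<bar>)" if ij: "i \<in> R" "j \<in> R" "i \<noteq> j" for i j
      proof -
        have jk: "\<bar>i k\<bar> < int J" "\<bar>j k\<bar> < int J" for k using ij by (auto simp: R_def)
        have "real_of_int \<bar>i k - j k\<bar> \<le> 2 * real J" for k
          using jk[of k] by linarith
        moreover have "(\<lambda>k. i k - j k) \<noteq> (\<lambda>k. 0)" using ij(3) by (auto simp: fun_eq_iff)
        ultimately have "\<kappa> \<le> (\<Prod>u\<in>UNIV. dist_int (L (\<lambda>k. i k - j k) u))"
          unfolding \<kappa>_def L_def by (intro lower)
        also have "\<dots> \<le> (\<Prod>u\<in>UNIV. \<bar>f i u - f j u\<bar>)"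
        \<comment> \<open>Modulo 1, \<open>f i u - f j u\<close> agrees with the linear form at
          \<open>i - j\<close>, so its absolute value is at least the distance of that form to the
          integers.\<close>
        proof (intro prod_mono conjI dist_int_nonneg)
          fix u
          have L: "L (\<lambda>k. i k - j k) u = L i u - L j u"
            by (simp add: L_def left_diff_distrib sum_subtractf)
          show "dist_int (L (\<lambda>k. i k - j k) u) \<le> \<bar>f i u - f j u\<bar>"
            unfolding L using dist_int_le[of "L i u - L j u" "round (L i u) - round (L j u)"]
            by (simp add: f_def algebra_simps)
        qed
        finally show ?thesis .
      qed
    qed
    also have "\<dots> \<le> (D * (1 / \<kappa>) powr \<epsilon>) ^ l * ((2 ^ l + 1) / \<kappa>)"
    proof -
      have "log 2 (1 / \<kappa>) \<ge> 0" using \<kappa>0 \<kappa>1 by simp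
      moreover have "2 * (log 2 (1 / \<kappa>) + 2) \<le> D * (1 / \<kappa>) powr \<epsilon>"
        unfolding D_def mult.assoc using \<kappa>0 \<kappa>1 \<epsilon> by (intro mult_left_mono log2_le_powr) auto
      ultimately show ?thesis
        unfolding l_def using \<kappa>0 by (intro mult_right_mono power_mono) auto
    qed
    also have "\<dots> = D ^ l * (2 ^ l + 1) * (1 / \<kappa>) powr s"
    proof -
      have "((1 / \<kappa>) powr \<epsilon>) ^ l * (1 / \<kappa>) = (1 / \<kappa>) powr (\<epsilon> * real l + 1)"
        using \<kappa>0 by (simp add: powr_add powr_realpow[symmetric] powr_powr)
      also have "\<epsilon> * real l + 1 = s" using l by (simp add: \<epsilon>_def)
      finally have "((1 / \<kappa>) powr \<epsilon>) ^ l * (1 / \<kappa>) = (1 / \<kappa>) powr s" .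
      then show ?thesis by (simp add: power_mult_distrib flip: \<open>_ = (1 / \<kappa>) powr s\<close>)
    qed
    also have "(1 / \<kappa>) powr s = c powr (- s) * 2 powr \<omega>' * real J powr \<omega>'"
    proof -
      have "(1 / \<kappa>) powr s = \<kappa> powr (- s)" using \<kappa>0 by (simp add: powr_divide powr_minus_divide)
      also have "\<dots> = c powr (- s) * (2 * real J) powr (\<omega> * s)"
        using assms J by (simp add: \<kappa>_def powr_mult powr_powr)
      also have "\<omega> * s = \<omega>'" using assms by (simp add: s_def)
      finally show ?thesis by (simp add: powr_mult)
    qed
    finally have "(\<Sum>j\<in>R. \<Prod>u\<in>UNIV. 1 / \<bar>f j u\<bar>) \<le> C * real J powr \<omega>'"
      by (simp add: C_def mult.assoc)
    then show "(\<Sum>j \<in> {j. \<forall>k. \<bar>j k\<bar> < int J} - {\<lambda>k. 0}.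
       \<Prod>u\<in>UNIV. 1 / dist_int (\<Sum>k\<in>UNIV. of_int (j k) * M u k)) \<le> C * real J powr \<omega>'"
      by (simp only: absf R_def L_def)
  qed
qed

text \<open>With \<open>J\<close> about \<open>1 / (6 * \<delta>)\<close>, the condition on
  \<open>\<delta>\<close> gives \<open>J \<le> N powr \<tau>\<close>, and \<open>\<tau>\<close> is
  chosen so that the error \<open>J powr \<omega>'\<close> does not exceed the main term
  \<open>N ^ l\<close>.\<close>

lemma card_close_points_bound:
  fixes M :: "real ^ 'm ^ 'l" and n :: nat
  assumes "dioph_type M < ereal (real (CARD('l) * n))" "n > 0"
  obtains \<tau> C where "\<tau> * real n > 1" "C > 0"
    "\<And>(N :: nat) \<delta> \<beta> (a :: 'l \<Rightarrow> int). N \<ge> 1 \<Longrightarrow> \<delta> \<ge> real N powr (- \<tau>) \<Longrightarrow>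
      real (card {b \<in> PiE UNIV (\<lambda>u. {a u..<a u + int N}).
        \<forall>k. dist_int (\<beta> k + (\<Sum>u\<in>UNIV. of_int (b u) * M $ u $ k)) < \<delta>})
      \<le> C * \<delta> ^ CARD('m) * real N ^ CARD('l)"
proof -
  define l where "l = CARD('l)"
  have l: "l > 0" by (simp add: l_def)
  obtain \<omega> c where \<omega>: "0 < \<omega>" "\<omega> < real (l * n)" and c: "0 < c" "c \<le> 1"
    and lower: "\<And>(j :: 'm \<Rightarrow> int) K. j \<noteq> (\<lambda>k. 0) \<Longrightarrow> (\<And>k. real_of_int \<bar>j k\<bar> \<le> K) \<Longrightarrow>
      c * K powr (- \<omega>) \<le> (\<Prod>u\<in>UNIV. dist_int (\<Sum>k\<in>UNIV. of_int (j k) * M $ u $ k))"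
    by (rule dioph_type_lower_bound[OF assms(1)[folded l_def]]) (use l assms(2) in auto)
  obtain \<omega>' where \<omega>': "\<omega> < \<omega>'" "\<omega>' < real (l * n)" using \<omega>(2) dense by blast
  obtain C where C: "C > 0" and
    S: "\<And>J :: nat. J \<ge> 1 \<Longrightarrow> (\<Sum>j \<in> {j. \<forall>k. \<bar>j k\<bar> < int J} - {\<lambda>k. 0}.
       \<Prod>u\<in>UNIV. 1 / dist_int (\<Sum>k\<in>UNIV. of_int (j k) * M $ u $ k)) \<le> C * real J powr \<omega>'"
    using sum_inverse_dist_int_bound[OF \<omega>(1) \<omega>'(1) c, of "\<lambda>u k. M $ u $ k"] lower by blast
  \<comment> \<open>Then \<open>\<tau> * \<omega>' = l\<close>, and \<open>\<omega>' < l * n\<close>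
    is exactly \<open>\<tau> * n > 1\<close>.\<close>
  define \<tau> where "\<tau> = real l / \<omega>'"
  have \<tau>: "\<tau> > 0" using l \<omega> \<omega>' by (simp add: \<tau>_def)
  have pos: "dist_int (\<Sum>k\<in>UNIV. of_int (j k) * M $ u $ k) > 0"
    if j: "j \<noteq> (\<lambda>k. 0)" and bd: "\<And>k. \<bar>j k\<bar> < int J" for j :: "'m \<Rightarrow> int" and u J
  proof -
    fix k0 :: 'm
    have "int J > 0" using bd[of k0] by linarith
    moreover have "real_of_int \<bar>j k\<bar> \<le> real J" for k using bd[of k] by linarith
    then have "c * real J powr (- \<omega>) \<le> (\<Prod>u\<in>UNIV. dist_int (\<Sum>k\<in>UNIV. of_int (j k) * M $ u $ k))"
      using j by (intro lower)
    moreover have "c * real J powr (- \<omega>) > 0" using c \<open>int J > 0\<close> by simp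
    ultimately have "(\<Prod>u\<in>UNIV. dist_int (\<Sum>k\<in>UNIV. of_int (j k) * M $ u $ k)) \<noteq> 0" by linarith
    then have "dist_int (\<Sum>k\<in>UNIV. of_int (j k) * M $ u $ k) \<noteq> 0" by simp
    then show ?thesis using dist_int_nonneg[of "\<Sum>k\<in>UNIV. of_int (j k) * M $ u $ k"] by linarith
  qed
  show thesis
  \<comment> \<open>The floor in \<open>J\<close> loses at most a factor 2, so
    \<open>4 / J \<le> 48 * \<delta>\<close>. For \<open>\<delta> > 1 / 6\<close> the trivial count
    suffices, as \<open>48 * \<delta>\<close> then exceeds 1.\<close>
  proof (rule that[of \<tau> "48 ^ CARD('m) * (1 + C)"])
    show "\<tau> * real n > 1" using \<omega> \<omega>' by (simp add: \<tau>_def)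
    show "48 ^ CARD('m) * (1 + C) > 0" using C by simp
    fix N :: nat and \<delta> and \<beta> :: "'m \<Rightarrow> real" and a :: "'l \<Rightarrow> int"
    assume N: "N \<ge> 1" and \<delta>N: "\<delta> \<ge> real N powr (- \<tau>)"
    have \<delta>: "\<delta> > 0" using \<delta>N N by (smt (verit) of_nat_0_less_iff powr_gt_zero not_one_le_zero neq0_conv)
    define G where "G = {b \<in> PiE UNIV (\<lambda>u. {a u..<a u + int N}).
        \<forall>k. dist_int (\<beta> k + (\<Sum>u\<in>UNIV. of_int (b u) * M $ u $ k)) < \<delta>}"
    have "real (card G) \<le> 48 ^ CARD('m) * (1 + C) * \<delta> ^ CARD('m) * real N ^ CARD('l)"
    proof (cases "\<delta> \<le> 1 / 6")
      case False
      have "card G \<le> card (PiE (UNIV :: 'l set) (\<lambda>u. {a u..<a u + int N}))"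
        unfolding G_def by (intro card_mono) (auto intro: finite_PiE)
      then have "card G \<le> N ^ CARD('l)" by (simp add: card_PiE)
      then have "real (card G) \<le> 1 * real N ^ CARD('l)"
        by (simp flip: of_nat_power)
      also have "\<dots> \<le> ((48 * \<delta>) ^ CARD('m) * (1 + C)) * real N ^ CARD('l)"
      proof (intro mult_right_mono)
        have "1 * 1 \<le> (48 * \<delta>) ^ CARD('m) * (1 + C)"
          using False C by (intro mult_mono one_le_power) auto
        then show "1 \<le> (48 * \<delta>) ^ CARD('m) * (1 + C)" by simp
      qed simp
      finally show ?thesis by (simp add: power_mult_distrib mult_ac)
    next
      case True
      define J where "J = nat \<lfloor>1 / (6 * \<delta>)\<rfloor>"
      have x: "1 / (6 * \<delta>) \<ge> 1" using True \<delta> by (simp add: field_simps)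
      have J: "real J \<le> 1 / (6 * \<delta>)" "1 / (6 * \<delta>) < real J + 1" "J \<ge> 1"
        using x unfolding J_def by linarith+
      have "1 / (6 * \<delta>) \<le> 2 * real J" using J by linarith
      then have J4: "4 / real J \<le> 48 * \<delta>" using J(3) \<delta> by (simp add: field_simps)
      have J6: "6 * (real J * \<delta>) \<le> 1" using J(1) \<delta> by (simp add: field_simps)
      have "real J \<le> real N powr \<tau>"
      proof -
        have "real J \<le> 1 / \<delta>" using J(1) \<delta> by (simp add: field_simps)
        also have "\<dots> \<le> 1 / real N powr (- \<tau>)"
          using \<delta>N \<delta> N by (intro divide_left_mono mult_pos_pos) auto
        finally show ?thesis by (simp add: powr_minus_divide)
      qed
      then have "real J powr \<omega>' \<le> (real N powr \<tau>) powr \<omega>'"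
        using \<omega> \<omega>' by (intro powr_mono2) auto
      also have "\<dots> = real N ^ l"
        using \<omega> \<omega>' N by (simp add: powr_powr \<tau>_def powr_realpow)
      finally have JN: "real J powr \<omega>' \<le> real N ^ l" .
      have "real (card G) \<le> (4 / real J) ^ CARD('m) * (real N ^ CARD('l) +
      (\<Sum>j \<in> {j. \<forall>k. \<bar>j k\<bar> < int J} - {\<lambda>k. 0}.
         \<Prod>u\<in>UNIV. 1 / dist_int (\<Sum>k\<in>UNIV. of_int (j k) * M $ u $ k)))"
        unfolding G_def by (intro card_close_points_le J(3) J6 pos)
      also have "\<dots> \<le> (48 * \<delta>) ^ CARD('m) * (real N ^ l + C * real N ^ l)"
      proof (intro mult_mono power_mono add_mono J4)
        have "C * real J powr \<omega>' \<le> C * real N ^ l" using JN C by (intro mult_left_mono) auto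
        then show "(\<Sum>j \<in> {j. \<forall>k. \<bar>j k\<bar> < int J} - {\<lambda>k. 0}.
         \<Prod>u\<in>UNIV. 1 / dist_int (\<Sum>k\<in>UNIV. of_int (j k) * M $ u $ k)) \<le> C * real N ^ l"
          using S[OF J(3)] by linarith
      qed (use \<delta> C in \<open>auto simp: l_def intro!: add_nonneg_nonneg sum_nonneg prod_nonneg dist_int_nonneg\<close>)
      finally show ?thesis
        by (simp add: power_mult_distrib l_def algebra_simps)
    qed
    then show "real (card {b \<in> PiE UNIV (\<lambda>u. {a u..<a u + int N}).
        \<forall>k. dist_int (\<beta> k + (\<Sum>u\<in>UNIV. of_int (b u) * M $ u $ k)) < \<delta>})
      \<le> 48 ^ CARD('m) * (1 + C) * \<delta> ^ CARD('m) * real N ^ CARD('l)"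
      by (simp only: G_def)
  qed
qed

subsection \<open>Covering by cubes around rational points\<close>

lemma dist_int_vec_less_iff: "dist_int_vec y < \<delta> \<longleftrightarrow> (\<forall>k. dist_int (y $ k) < \<delta>)"
  unfolding dist_int_vec_def by (subst Max_less_iff) auto

lemma simul_approx_iff:
  "x \<in> simul_approx \<psi> \<longleftrightarrow> infinite {q. q \<ge> 1 \<and> (\<forall>i. dist_int (real q * x $ i) < \<psi> q)}"
  by (simp add: simul_approx_def dist_int_vec_less_iff)

lemma aff_param_Inl: "aff_param \<alpha> A x $ Inl u = x $ u"
  by (simp add: aff_param_eq append_vec_def)

lemma aff_param_Inr: "aff_param \<alpha> A x $ Inr k = \<alpha> $ k + (\<Sum>u\<in>UNIV. x $ u * A $ u $ k)"
  by (simp add: aff_param_eq append_vec_def vector_matrix_mult_def mult.commute)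

section \<open>Measurability, null sets on the subspace and volumes of cubes\<close>

lemma borel_measurable_dist_int: "dist_int \<in> borel_measurable borel"
  unfolding dist_int_def[abs_def] round_def by measurable

lemma simul_approx_borel: "simul_approx \<psi> \<in> sets (borel :: (real ^ 'n) measure)"
proof -
  note [measurable] = borel_measurable_dist_int
  have "simul_approx \<psi> = {x :: real ^ 'n.
      \<forall>m. \<exists>q. m < q \<and> q \<ge> 1 \<and> (\<forall>i. dist_int (real q * x $ i) < \<psi> q)}"
    unfolding simul_approx_iff[abs_def, symmetric] set_eq_iff
    by (auto simp: simul_approx_iff infinite_nat_iff_unbounded)
  also have "\<dots> \<in> sets borel" by measurable
  finally show ?thesis .
qed

text \<open>Transfers the question to Lebesgue measure on the parameter space: the induced measure
  is a constant multiple of an image measure, completed.\<close>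

lemma aff_subspace_Int_null_setsI:
  assumes "B \<in> sets borel" "AE x in lborel. aff_param \<alpha> A x \<notin> B"
  shows "aff_subspace \<alpha> A \<inter> B \<in> null_sets (induced_lebesgue \<alpha> A)"
proof -
  have meas: "aff_subspace \<alpha> A \<inter> B \<in> sets (restrict_space borel (aff_subspace \<alpha> A))"
    using assms by (auto simp: sets_restrict_space)
  have "{x. aff_param \<alpha> A x \<in> B} \<in> sets lborel"
    using measurable_sets[OF borel_measurable_continuous_onI[OF continuous_aff_param] assms(1)]
    by (simp add: vimage_def)
  then have "emeasure lborel {x. aff_param \<alpha> A x \<in> B} = 0"
    using assms(2) by (subst (asm) AE_iff_measurable[OF _ refl]) auto
  moreover have "aff_param \<alpha> A -` (aff_subspace \<alpha> A \<inter> B) = {x. aff_param \<alpha> A x \<in> B}"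
    by (auto simp: aff_subspace_def)
  ultimately show ?thesis
    using meas by (auto simp: null_sets_def induced_lebesgue_def emeasure_distr[OF measurable_aff_param])
qed

lemma emeasure_lborel_cube:
  fixes y :: "'d::finite \<Rightarrow> real"
  assumes "r \<ge> 0"
  shows "emeasure lborel (cbox (\<chi> u. y u - r) (\<chi> u. y u + r)) = ennreal ((2 * r) ^ CARD('d))"
proof -
  have "emeasure lborel (cbox (\<chi> u. y u - r) (\<chi> u. y u + r))
      = ennreal (measure lborel (cbox (\<chi> u. y u - r) (\<chi> u. y u + r)))"
    by (simp add: emeasure_lborel_cbox_eq measure_def enn2real_ennreal)
  also have "measure lborel (cbox (\<chi> u. y u - r) (\<chi> u. y u + r)) = (2 * r) ^ CARD('d)"
    using assms by (subst content_cbox_cart) (auto simp: interval_ne_empty_cart)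
  finally show ?thesis .
qed

text \<open>The box contains the nearest integer vector to \<open>q x\<close> whenever \<open>q \<le> 2 Q\<close> and \<open>\<bar>x\<bar> \<le> R\<close>; the factor
  in front of \<open>\<delta>\<close> absorbs the error of replacing \<open>q x\<close> by that vector.\<close>

definition approx_pairs ::
    "real ^ 'm \<Rightarrow> real ^ 'm ^ 'd \<Rightarrow> nat set \<Rightarrow> nat \<Rightarrow> nat \<Rightarrow> real \<Rightarrow> (nat \<times> ('d \<Rightarrow> int)) set" where
  "approx_pairs \<alpha> A D Q R \<delta> = {(q, a). q \<in> D \<and>
     a \<in> PiE UNIV (\<lambda>_. {- int (2 * Q * R + 1)..<- int (2 * Q * R + 1) + int (7 * Q * R)}) \<and>
     (\<forall>k. dist_int (real q * \<alpha> $ k + (\<Sum>u\<in>UNIV. of_int (a u) * A $ u $ k))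
        < (1 + (\<Sum>u\<in>UNIV. \<Sum>k\<in>UNIV. \<bar>A $ u $ k\<bar>)) * \<delta>)}"

lemma finite_approx_pairs: "finite D \<Longrightarrow> finite (approx_pairs \<alpha> A D Q R \<delta>)"
proof (rule finite_subset)
  show "approx_pairs \<alpha> A D Q R \<delta> \<subseteq> D \<times>
    PiE UNIV (\<lambda>_. {- int (2 * Q * R + 1)..<- int (2 * Q * R + 1) + int (7 * Q * R)})"
    by (auto simp: approx_pairs_def)
qed (intro finite_cartesian_product finite_PiE, auto)

text \<open>The witness \<open>a\<close> is the nearest integer vector to \<open>q x\<close>.
  Dividing its error, below \<open>\<delta>\<close>, by \<open>q \<ge> Q\<close> gives the radius of
  the cube; passing from \<open>q x\<close> to \<open>a\<close> costs at most
  \<open>\<delta>\<close> times the sum of the \<open>\<bar>A $ u $ k\<bar>\<close>.\<close>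

lemma close_point_in_approx_cube:
  fixes A :: "real ^ 'm ^ 'd"
  assumes Q: "Q \<ge> 1" "R \<ge> 1" "q \<in> D" "Q \<le> q" "q \<le> 2 * Q"
    and x: "\<And>u. \<bar>x $ u\<bar> \<le> real R"
    and close: "\<And>i. dist_int (real q * aff_param \<alpha> A x $ i) < \<delta>"
  shows "\<exists>a. (q, a) \<in> approx_pairs \<alpha> A D Q R \<delta> \<and>
    x \<in> cbox (\<chi> u. of_int (a u) / real q - \<delta> / real Q)
             (\<chi> u. of_int (a u) / real q + \<delta> / real Q)"
proof -
  define a where "a u = round (real q * x $ u)" for u
  have q: "real q > 0" using Q by simp
  have a: "\<bar>real q * x $ u - of_int (a u)\<bar> < \<delta>" for u
    using close[of "Inl u"] by (simp add: aff_param_Inl a_def dist_int_def)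
  have \<delta>: "\<delta> > 0" using a[of undefined] by linarith
  have box: "a u \<in> {- int (2 * Q * R + 1)..<- int (2 * Q * R + 1) + int (7 * Q * R)}" for u
  proof -
    have "\<bar>real q * x $ u\<bar> \<le> real (2 * Q) * real R"
      unfolding abs_mult using Q x by (intro mult_mono) auto
    moreover have "\<bar>real q * x $ u - of_int (a u)\<bar> \<le> 1 / 2"
      using of_int_round_abs_le[of "real q * x $ u"] by (simp add: a_def abs_minus_commute)
    moreover have "real (2 * Q * R + 1) = real (2 * Q) * real R + 1" by simp
    ultimately have "\<bar>real_of_int (a u)\<bar> \<le> real (2 * Q * R + 1)" by linarith
    then have "\<bar>a u\<bar> \<le> int (2 * Q * R + 1)" by linarith
    \<comment> \<open>This is the source of the side \<open>7 * Q * R\<close>: it must exceed twice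
      the bound \<open>2 * Q * R + 1\<close> for the entries of \<open>a\<close>.\<close>
    moreover have "2 * (2 * p + 1) < 7 * p" if "1 \<le> p" for p :: nat using that by simp
    from this[of "Q * R"] have "2 * (2 * Q * R + 1) < 7 * Q * R"
      using Q by (simp add: mult.assoc)
    then have "2 * int (2 * Q * R + 1) < int (7 * Q * R)" by linarith
    moreover have "z \<in> {- B..<- B + L}" if "\<bar>z\<bar> \<le> B" "2 * B < L" for z B L :: int
      using that by auto
    ultimately show ?thesis by blast
  qed
  have "dist_int (real q * \<alpha> $ k + (\<Sum>u\<in>UNIV. of_int (a u) * A $ u $ k))
        < (1 + (\<Sum>u\<in>UNIV. \<Sum>k\<in>UNIV. \<bar>A $ u $ k\<bar>)) * \<delta>" for k
  proof -
    define E where "E = (\<Sum>u\<in>UNIV. (of_int (a u) - real q * x $ u) * A $ u $ k)"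
    have "\<bar>E\<bar> \<le> (\<Sum>u\<in>UNIV. \<bar>(of_int (a u) - real q * x $ u) * A $ u $ k\<bar>)"
      unfolding E_def by (rule sum_abs)
    also have "\<dots> \<le> (\<Sum>u\<in>UNIV. \<delta> * (\<Sum>k\<in>UNIV. \<bar>A $ u $ k\<bar>))"
    proof (rule sum_mono)
      fix u
      have "\<bar>A $ u $ k\<bar> \<le> (\<Sum>k\<in>UNIV. \<bar>A $ u $ k\<bar>)"
        by (intro member_le_sum) auto
      then show "\<bar>(of_int (a u) - real q * x $ u) * A $ u $ k\<bar> \<le> \<delta> * (\<Sum>k\<in>UNIV. \<bar>A $ u $ k\<bar>)"
        unfolding abs_mult using a[of u] \<delta> by (intro mult_mono) (auto simp: abs_minus_commute)
    qed
    also have "\<dots> = \<delta> * (\<Sum>u\<in>UNIV. \<Sum>k\<in>UNIV. \<bar>A $ u $ k\<bar>)"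
      by (simp add: sum_distrib_left)
    finally have E: "\<bar>E\<bar> \<le> \<delta> * (\<Sum>u\<in>UNIV. \<Sum>k\<in>UNIV. \<bar>A $ u $ k\<bar>)" .
    have "real q * \<alpha> $ k + (\<Sum>u\<in>UNIV. of_int (a u) * A $ u $ k)
        = real q * aff_param \<alpha> A x $ Inr k + E"
      by (simp add: E_def aff_param_Inr algebra_simps sum_subtractf sum_distrib_left)
    then have "dist_int (real q * \<alpha> $ k + (\<Sum>u\<in>UNIV. of_int (a u) * A $ u $ k))
        \<le> dist_int (real q * aff_param \<alpha> A x $ Inr k) + \<bar>E\<bar>"
      using dist_int_add_le by metis
    also have "\<dots> < \<delta> + \<delta> * (\<Sum>u\<in>UNIV. \<Sum>k\<in>UNIV. \<bar>A $ u $ k\<bar>)"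
      using close[of "Inr k"] E by linarith
    finally show ?thesis by (simp add: algebra_simps)
  qed
  then have "(q, a) \<in> approx_pairs \<alpha> A D Q R \<delta>"
    using box Q by (auto simp: approx_pairs_def)
  moreover have "\<bar>x $ u - of_int (a u) / real q\<bar> \<le> \<delta> / real Q" for u
  proof -
    have "x $ u - of_int (a u) / real q = (real q * x $ u - of_int (a u)) / real q"
      using q by (simp add: field_simps)
    then have "\<bar>x $ u - of_int (a u) / real q\<bar> = \<bar>real q * x $ u - of_int (a u)\<bar> / real q"
      by simp
    also have "\<dots> \<le> \<delta> / real Q"
      using a[of u] Q by (intro frac_le) auto
    finally show ?thesis .
  qed
  then have "x \<in> cbox (\<chi> u. of_int (a u) / real q - \<delta> / real Q)
             (\<chi> u. of_int (a u) / real q + \<delta> / real Q)"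
    by (auto simp: mem_box_cart abs_le_iff) (smt (verit))+
  ultimately show ?thesis by blast
qed

text \<open>Borel-Cantelli over blocks \<open>D t\<close> of denominators, in a form that serves
  both theorems: singletons in the strong case, dyadic intervals in the monotone one. The constant
  \<open>K\<close> may depend on the radius \<open>R\<close>, because the parameter space is
  exhausted by countably many bounded cubes.\<close>

lemma null_sets_by_block_counting:
  fixes A :: "real ^ 'm ^ 'd" and D :: "nat \<Rightarrow> nat set" and Q :: "nat \<Rightarrow> nat"
  assumes D: "\<And>t. D t \<subseteq> {Q t..2 * Q t}" "\<And>q. q \<ge> 1 \<Longrightarrow> \<exists>t. q \<in> D t"
    and Q: "\<And>t. Q t \<ge> 1"
    and \<delta>: "\<And>t. \<delta> t \<ge> 0" "\<And>t q. q \<in> D t \<Longrightarrow> \<psi> q \<le> \<delta> t"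
    and summable: "summable g"
    and count: "\<And>R. R \<ge> 1 \<Longrightarrow> \<exists>K. \<forall>t. real (card (approx_pairs \<alpha> A (D t) (Q t) R (\<delta> t))) *
        (2 * (\<delta> t / real (Q t))) ^ CARD('d) \<le> K * g t"
  shows "aff_subspace \<alpha> A \<inter> simul_approx \<psi> \<in> null_sets (induced_lebesgue \<alpha> A)"
proof (rule aff_subspace_Int_null_setsI[OF simul_approx_borel])
  have finD: "finite (D t)" for t using D(1) by (rule finite_subset) simp
  define cube where "cube t = (\<lambda>(q, a). cbox
      (\<chi> u. of_int (a u) / real q - \<delta> t / real (Q t))
      (\<chi> u. of_int (a u) / real q + \<delta> t / real (Q t)) :: (real ^ 'd) set)"
    for t
  have AE_R: "AE x in lborel. (\<forall>u. \<bar>x $ u\<bar> \<le> real R) \<longrightarrow> aff_param \<alpha> A x \<notin> simul_approx \<psi>"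
    if R: "R \<ge> 1" for R
  proof -
    define W where "W t = (\<Union>p\<in>approx_pairs \<alpha> A (D t) (Q t) R (\<delta> t). cube t p)" for t
    obtain K where K: "\<And>t. real (card (approx_pairs \<alpha> A (D t) (Q t) R (\<delta> t))) *
        (2 * (\<delta> t / real (Q t))) ^ CARD('d) \<le> K * g t"
      using count[OF R] by blast
    have cube_borel: "cube t p \<in> sets lborel" for t p
      by (auto simp: cube_def split: prod.splits)
    have W_borel: "W t \<in> sets lborel" for t
      unfolding W_def by (intro sets.finite_UN finite_approx_pairs finD cube_borel)
    have em: "emeasure lborel (W t) \<le> ennreal (K * g t)" for t
    proof -
      have "emeasure lborel (W t) \<le> (\<Sum>p\<in>approx_pairs \<alpha> A (D t) (Q t) R (\<delta> t). emeasure lborel (cube t p))"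
        unfolding W_def using cube_borel
        by (intro emeasure_subadditive_finite finite_approx_pairs finD) auto
      also have "\<dots> = (\<Sum>p\<in>approx_pairs \<alpha> A (D t) (Q t) R (\<delta> t).
          ennreal ((2 * (\<delta> t / real (Q t))) ^ CARD('d)))"
        by (intro sum.cong refl, simp only: cube_def split: prod.splits, intro allI impI emeasure_lborel_cube)
          (simp add: \<delta>)
      also have "\<dots> = ennreal (real (card (approx_pairs \<alpha> A (D t) (Q t) R (\<delta> t))) *
          (2 * (\<delta> t / real (Q t))) ^ CARD('d))"
        using \<delta> by (simp add: ennreal_mult ennreal_of_nat_eq_real_of_nat)
      also have "\<dots> \<le> ennreal (K * g t)" by (intro ennreal_leI K)
      finally show ?thesis .
    qed
    have "AE x in lborel. eventually (\<lambda>t. x \<in> space lborel - W t) sequentially"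
    proof (rule borel_cantelli_AE1[OF W_borel])
      show "emeasure lborel (W t) < \<infinity>" for t
        using em[of t] by (simp add: order_le_less_trans)
      show "summable (\<lambda>t. measure lborel (W t))"
      proof (rule summable_comparison_test')
        show "summable (\<lambda>t. K * g t)" using summable by (rule summable_mult)
        have "0 \<le> K * g t" for t
          using K[of t] \<delta>(1)[of t] by (smt (verit) divide_nonneg_nonneg mult_nonneg_nonneg of_nat_0_le_iff zero_le_power)
        then show "norm (measure lborel (W t)) \<le> K * g t" for t
          using em[of t] by (simp add: measure_def enn2real_leI)
      qed
    qed
    then show ?thesis
    proof (rule AE_mp, intro AE_I2 impI notI)
      fix x :: "real ^ 'd"
      assume ev: "eventually (\<lambda>t. x \<in> space lborel - W t) sequentially"
        and x: "\<forall>u. \<bar>x $ u\<bar> \<le> real R" and "aff_param \<alpha> A x \<in> simul_approx \<psi>"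
      then have inf: "infinite {q. q \<ge> 1 \<and> (\<forall>i. dist_int (real q * aff_param \<alpha> A x $ i) < \<psi> q)}"
        by (simp add: simul_approx_iff)
      obtain T where T: "\<And>t. t \<ge> T \<Longrightarrow> x \<notin> W t"
        using ev by (auto simp: eventually_sequentially)
      \<comment> \<open>Beyond index \<open>T\<close> no block contains a solution \<open>q\<close>,
        so all solutions lie in finitely many finite blocks.\<close>
      have "{q. q \<ge> 1 \<and> (\<forall>i. dist_int (real q * aff_param \<alpha> A x $ i) < \<psi> q)} \<subseteq> (\<Union>t<T. D t)"
      proof
        fix q assume "q \<in> {q. q \<ge> 1 \<and> (\<forall>i. dist_int (real q * aff_param \<alpha> A x $ i) < \<psi> q)}"
        then have q: "q \<ge> 1" "\<And>i. dist_int (real q * aff_param \<alpha> A x $ i) < \<psi> q" by auto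
        obtain t where t: "q \<in> D t" using D(2)[OF q(1)] by blast
        have "dist_int (real q * aff_param \<alpha> A x $ i) < \<delta> t" for i
          using q(2)[of i] \<delta>(2)[OF t] by linarith
        moreover have "Q t \<le> q" "q \<le> 2 * Q t" using D(1)[of t] t by auto
        ultimately obtain a where "(q, a) \<in> approx_pairs \<alpha> A (D t) (Q t) R (\<delta> t)" "x \<in> cube t (q, a)"
          using close_point_in_approx_cube[OF Q R t] x unfolding cube_def prod.case by blast
        then have "x \<in> W t" unfolding W_def by blast
        then show "q \<in> (\<Union>t<T. D t)" using T t by (meson UN_I lessThan_iff not_le)
      qed
      then show False using inf finD finite_subset by blast
    qed
  qed
  have "AE x in lborel. \<forall>R. (\<forall>u. \<bar>x $ u\<bar> \<le> real (Suc R)) \<longrightarrow> aff_param \<alpha> A x \<notin> simul_approx \<psi>"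
    unfolding AE_all_countable by (intro allI AE_R) simp
  then show "AE x in lborel. aff_param \<alpha> A x \<notin> simul_approx \<psi>"
  proof (rule AE_mp, intro AE_I2 impI)
    fix x :: "real ^ 'd"
    assume *: "\<forall>R. (\<forall>u. \<bar>x $ u\<bar> \<le> real (Suc R)) \<longrightarrow> aff_param \<alpha> A x \<notin> simul_approx \<psi>"
    obtain R where "norm x \<le> real R" using real_arch_simple by blast
    then have "\<bar>x $ u\<bar> \<le> real (Suc R)" for u
      using component_le_norm_cart[of x u] by simp
    then show "aff_param \<alpha> A x \<notin> simul_approx \<psi>" using * by blast
  qed
qed

subsection \<open>Convergence theorems\<close>

text \<open>Raising \<open>\<psi>\<close> to at least \<open>q powr (- \<tau>)\<close> meets the
  lower bound on the radius in the counting estimate; \<open>\<tau> * n > 1\<close> keeps the series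
  convergent.\<close>

lemma summable_max_powr:
  fixes \<psi> :: "nat \<Rightarrow> real"
  assumes "\<And>q. q \<ge> 1 \<Longrightarrow> \<psi> q \<ge> 0" "summable (\<lambda>q. \<psi> (Suc q) ^ n)" "\<tau> * real n > 1"
  shows "summable (\<lambda>q. max (\<psi> (Suc q)) (real (Suc q) powr (- \<tau>)) ^ n)"
proof (rule summable_comparison_test')
  have "summable (\<lambda>q. real q powr (- (\<tau> * real n)))"
    using assms(3) by (simp add: summable_real_powr_iff)
  then have "summable (\<lambda>q. real (Suc q) powr (- (\<tau> * real n)))"
    by (subst summable_Suc_iff)
  then show "summable (\<lambda>q. \<psi> (Suc q) ^ n + real (Suc q) powr (- (\<tau> * real n)))"
    using assms(2) by (intro summable_add)
  fix q :: nat
  have p: "(real (Suc q) powr (- \<tau>)) ^ n = real (Suc q) powr (- (\<tau> * real n))"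
    by (simp add: powr_realpow[symmetric] powr_powr)
  have "max (\<psi> (Suc q)) (real (Suc q) powr (- \<tau>)) ^ n
      \<le> \<psi> (Suc q) ^ n + (real (Suc q) powr (- \<tau>)) ^ n"
    using assms(1)[of "Suc q"] by (auto simp: max_def)
  then show "norm (max (\<psi> (Suc q)) (real (Suc q) powr (- \<tau>)) ^ n)
      \<le> \<psi> (Suc q) ^ n + real (Suc q) powr (- (\<tau> * real n))"
    unfolding p using assms(1)[of "Suc q"] by simp
qed

lemma sum_UNIV_option:
  fixes f :: "'a::finite option \<Rightarrow> 'b::comm_monoid_add"
  shows "(\<Sum>i\<in>UNIV. f i) = f None + (\<Sum>k\<in>UNIV. f (Some k))"
  by (simp add: UNIV_option_conv sum.reindex)

lemma scaled_radius_ge: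
  assumes "\<delta> \<ge> real Q powr (- \<tau>)" "Q \<ge> 1" "Q \<le> N" "\<tau> \<ge> 0" "c \<ge> 1"
  shows "c * \<delta> \<ge> real N powr (- \<tau>)"
proof -
  have "real N powr (- \<tau>) \<le> real Q powr (- \<tau>)"
    using assms by (intro powr_mono2') auto
  also have "\<dots> \<le> \<delta>" by (rule assms)
  also have "\<dots> \<le> c * \<delta>"
  proof -
    have "\<delta> \<ge> 0" using assms(1) powr_ge_zero order_trans by blast
    then show ?thesis using mult_right_mono[OF assms(5), of \<delta>] by simp
  qed
  finally show ?thesis .
qed

text \<open>For a single \<open>q\<close>, the vector \<open>q \<alpha>\<close> acts as the shift
  \<open>\<beta>\<close>. The count of order \<open>\<delta> ^ m * q ^ d\<close> times the cube
  volume of order \<open>(\<delta> / q) ^ d\<close> is of order \<open>\<delta> ^ (d + m)\<close>,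
  which is summable.\<close>

lemma strong_Khintchine_convergence_aff_subspace:
  fixes A :: "real ^ 'm ^ 'd" and \<alpha> :: "real ^ 'm"
  assumes "dioph_type A < ereal (real (CARD('d) * CARD('d + 'm)))"
  shows "strong_Khintchine_convergence (aff_subspace \<alpha> A) (induced_lebesgue \<alpha> A)"
  unfolding strong_Khintchine_convergence_def
proof (intro allI impI)
  fix \<psi> :: "nat \<Rightarrow> real"
  assume \<psi>: "\<forall>q\<ge>1. \<psi> q \<ge> 0" and sm: "summable (\<lambda>q. \<psi> (Suc q) ^ CARD('d + 'm))"
  define c where "c = 1 + (\<Sum>u\<in>UNIV. \<Sum>k\<in>UNIV. \<bar>A $ u $ k\<bar>)"
  have c: "c \<ge> 1" by (simp add: c_def sum_nonneg)
  obtain \<tau> C where \<tau>: "\<tau> * real CARD('d + 'm) > 1" and C: "C > 0"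
    and count: "\<And>(N :: nat) \<delta> \<beta> (a :: 'd \<Rightarrow> int). N \<ge> 1 \<Longrightarrow> \<delta> \<ge> real N powr (- \<tau>) \<Longrightarrow>
      real (card {b \<in> PiE UNIV (\<lambda>u. {a u..<a u + int N}).
        \<forall>k. dist_int (\<beta> k + (\<Sum>u\<in>UNIV. of_int (b u) * A $ u $ k)) < \<delta>})
      \<le> C * \<delta> ^ CARD('m) * real N ^ CARD('d)"
    using card_close_points_bound[OF assms zero_less_card_finite] by blast
  have \<tau>0: "\<tau> \<ge> 0" using \<tau> by (smt (verit) mult_nonpos_nonneg of_nat_0_le_iff)
  define \<delta> where "\<delta> t = max (\<psi> (Suc t)) (real (Suc t) powr (- \<tau>))" for t
  show "aff_subspace \<alpha> A \<inter> simul_approx \<psi> \<in> null_sets (induced_lebesgue \<alpha> A)"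
  proof (rule null_sets_by_block_counting[where D = "\<lambda>t. {Suc t}" and Q = Suc and \<delta> = \<delta>])
    show "summable (\<lambda>t. \<delta> t ^ CARD('d + 'm))"
      unfolding \<delta>_def using \<psi> sm \<tau> by (intro summable_max_powr) auto
    show "\<exists>t. q \<in> {Suc t}" if "q \<ge> 1" for q
      using that by (intro exI[of _ "q - 1"]) auto
    show \<delta>0: "\<delta> t \<ge> 0" for t by (simp add: \<delta>_def le_max_iff_disj)
    fix R :: nat assume R: "R \<ge> 1"
    show "\<exists>K. \<forall>t. real (card (approx_pairs \<alpha> A {Suc t} (Suc t) R (\<delta> t))) *
        (2 * (\<delta> t / real (Suc t))) ^ CARD('d) \<le> K * \<delta> t ^ CARD('d + 'm)"
    proof (intro exI allI)
      fix t
      define N where "N = 7 * Suc t * R"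
      have N: "Suc t \<le> N"
        using mult_le_mono[of "Suc t" "7 * Suc t" 1 R] R by (simp add: N_def)
      let ?S = "{b \<in> PiE UNIV (\<lambda>u :: 'd. {- int (2 * Suc t * R + 1)..<- int (2 * Suc t * R + 1) + int N}).
        \<forall>k. dist_int (real (Suc t) * \<alpha> $ k + (\<Sum>u\<in>UNIV. of_int (b u) * A $ u $ k)) < c * \<delta> t}"
      have "approx_pairs \<alpha> A {Suc t} (Suc t) R (\<delta> t) = Pair (Suc t) ` ?S"
        unfolding approx_pairs_def c_def N_def by auto
      then have "card (approx_pairs \<alpha> A {Suc t} (Suc t) R (\<delta> t)) = card ?S"
        by (simp add: card_image inj_on_def)
      also have "real \<dots> \<le> C * (c * \<delta> t) ^ CARD('m) * real N ^ CARD('d)"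
      proof (rule count)
        show "c * \<delta> t \<ge> real N powr (- \<tau>)"
          by (rule scaled_radius_ge[OF _ _ N \<tau>0 c]) (auto simp: \<delta>_def)
      qed (use N in simp)
      finally have "real (card (approx_pairs \<alpha> A {Suc t} (Suc t) R (\<delta> t))) *
          (2 * (\<delta> t / real (Suc t))) ^ CARD('d)
        \<le> C * (c * \<delta> t) ^ CARD('m) * real N ^ CARD('d) * (2 * (\<delta> t / real (Suc t))) ^ CARD('d)"
        using \<delta>0[of t] by (intro mult_right_mono) auto
      also have "\<dots> = C * (c * \<delta> t) ^ CARD('m) * (real N * (2 * (\<delta> t / real (Suc t)))) ^ CARD('d)"
        by (simp only: power_mult_distrib mult.assoc)
      also have "real N * (2 * (\<delta> t / real (Suc t))) = 14 * real R * \<delta> t"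
        by (simp only: N_def of_nat_mult of_nat_numeral) (simp add: field_simps del: of_nat_Suc)
      also have "C * (c * \<delta> t) ^ CARD('m) * (14 * real R * \<delta> t) ^ CARD('d)
          = (C * c ^ CARD('m) * (14 * real R) ^ CARD('d)) * \<delta> t ^ CARD('d + 'm)"
        by (simp add: power_mult_distrib power_add)
      finally show "real (card (approx_pairs \<alpha> A {Suc t} (Suc t) R (\<delta> t))) *
        (2 * (\<delta> t / real (Suc t))) ^ CARD('d)
        \<le> (C * c ^ CARD('m) * (14 * real R) ^ CARD('d)) * \<delta> t ^ CARD('d + 'm)" .
    qed
  qed (auto simp: \<delta>_def)
qed

text \<open>Here \<open>q\<close> varies over a dyadic block and becomes one more coordinate of the
  integer vector, multiplied by the row \<open>\<alpha>\<close>. The count gains a factor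
  \<open>Q\<close>, and \<open>Q * \<delta> ^ (d + m)\<close> is the term of the condensed series,
  which converges by monotonicity.\<close>

lemma Khintchine_convergence_aff_subspace:
  fixes A :: "real ^ 'm ^ 'd" and \<alpha> :: "real ^ 'm"
  assumes "dioph_type (adjoin_row \<alpha> A) < ereal (real ((CARD('d) + 1) * CARD('d + 'm)))"
  shows "Khintchine_convergence (aff_subspace \<alpha> A) (induced_lebesgue \<alpha> A)"
  unfolding Khintchine_convergence_def
proof (intro allI impI)
  fix \<psi> :: "nat \<Rightarrow> real"
  assume \<psi>: "\<forall>q\<ge>1. \<psi> q \<ge> 0" and anti: "antimono_on {1..} \<psi>"
    and sm: "summable (\<lambda>q. \<psi> (Suc q) ^ CARD('d + 'm))"
  define c where "c = 1 + (\<Sum>u\<in>UNIV. \<Sum>k\<in>UNIV. \<bar>A $ u $ k\<bar>)"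
  have c: "c \<ge> 1" by (simp add: c_def sum_nonneg)
  have card_option: "CARD('d option) = Suc CARD('d)" by (simp add: card_UNIV_option)
  have assms': "dioph_type (adjoin_row \<alpha> A) < ereal (real (CARD('d option) * CARD('d + 'm)))"
    using assms by (simp add: card_option)
  obtain \<tau> C where \<tau>: "\<tau> * real CARD('d + 'm) > 1" and C: "C > 0"
    and count: "\<And>(N :: nat) \<delta> \<beta> (a :: 'd option \<Rightarrow> int). N \<ge> 1 \<Longrightarrow> \<delta> \<ge> real N powr (- \<tau>) \<Longrightarrow>
      real (card {b \<in> PiE UNIV (\<lambda>u. {a u..<a u + int N}).
        \<forall>k. dist_int (\<beta> k + (\<Sum>u\<in>UNIV. of_int (b u) * adjoin_row \<alpha> A $ u $ k)) < \<delta>})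
      \<le> C * \<delta> ^ CARD('m) * real N ^ CARD('d option)"
    using card_close_points_bound[OF assms' zero_less_card_finite] by blast
  have \<tau>0: "\<tau> \<ge> 0" using \<tau> by (smt (verit) mult_nonpos_nonneg of_nat_0_le_iff)
  \<comment> \<open>The value at 0 is a default: the assumptions on \<open>\<psi>\<close> begin at
    1, and so does the monotonicity supplied to the condensation test.\<close>
  define \<phi> where "\<phi> q = (if q = 0 then 0 else max (\<psi> q) (real q powr (- \<tau>)))" for q
  have \<phi>0: "\<phi> q \<ge> 0" for q by (simp add: \<phi>_def le_max_iff_disj)
  have \<phi>_anti: "\<phi> q' \<le> \<phi> q" if "q \<ge> 1" "q \<le> q'" for q q'
  proof -
    have "\<psi> q' \<le> \<psi> q" using anti that by (auto simp: monotone_on_def)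
    moreover have "real q' powr (- \<tau>) \<le> real q powr (- \<tau>)"
      using that \<tau>0 by (intro powr_mono2') auto
    ultimately show ?thesis using that by (auto simp: \<phi>_def)
  qed
  have "summable (\<lambda>q. \<phi> (Suc q) ^ CARD('d + 'm))"
    unfolding \<phi>_def using summable_max_powr[of \<psi> "CARD('d + 'm)" \<tau>] \<psi> sm \<tau> by simp
  then have "summable (\<lambda>q. \<phi> q ^ CARD('d + 'm))" by (subst (asm) summable_Suc_iff)
  moreover have "\<phi> (Suc q) ^ CARD('d + 'm) \<le> \<phi> q ^ CARD('d + 'm)" if "0 < q" for q
    using that by (intro power_mono \<phi>_anti \<phi>0) auto
  ultimately have sum_g: "summable (\<lambda>t. 2 ^ t * \<phi> (2 ^ t) ^ CARD('d + 'm))"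
    using condensation_test[of "\<lambda>q. \<phi> q ^ CARD('d + 'm)"] \<phi>0 by simp
  show "aff_subspace \<alpha> A \<inter> simul_approx \<psi> \<in> null_sets (induced_lebesgue \<alpha> A)"
  proof (rule null_sets_by_block_counting[where D = "\<lambda>t. {2 ^ t..<2 ^ Suc t}" and Q = "\<lambda>t. 2 ^ t"
        and \<delta> = "\<lambda>t. \<phi> (2 ^ t)", OF _ _ _ _ _ sum_g])
    show "{2 ^ t..<2 ^ Suc t} \<subseteq> {2 ^ t..2 * 2 ^ t :: nat}" for t by auto
    show "\<exists>t. q \<in> {2 ^ t..<2 ^ Suc t}" if "q \<ge> 1" for q :: nat
      using ex_power_ivl1[of 2 q] that by auto
    show "\<psi> q \<le> \<phi> (2 ^ t)" if "q \<in> {2 ^ t..<2 ^ Suc t}" for t q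
    proof -
      have "q \<ge> 1" using that by (metis atLeastLessThan_iff one_le_numeral one_le_power order_trans)
      then have "\<psi> q \<le> \<phi> q" by (simp add: \<phi>_def)
      also have "\<dots> \<le> \<phi> (2 ^ t)" using that by (intro \<phi>_anti) auto
      finally show ?thesis .
    qed
    fix R :: nat assume R: "R \<ge> 1"
    show "\<exists>K. \<forall>t. real (card (approx_pairs \<alpha> A {2 ^ t..<2 ^ Suc t} (2 ^ t) R (\<phi> (2 ^ t)))) *
        (2 * (\<phi> (2 ^ t) / real (2 ^ t))) ^ CARD('d) \<le> K * (2 ^ t * \<phi> (2 ^ t) ^ CARD('d + 'm))"
    proof (intro exI allI)
      fix t
      define Q :: nat where "Q = 2 ^ t"
      define \<delta> where "\<delta> = \<phi> Q"
      have Q: "Q \<ge> 1" by (simp add: Q_def)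
      have \<delta>0: "\<delta> \<ge> 0" by (simp add: \<delta>_def \<phi>0)
      define N where "N = 7 * Q * R"
      have N: "Q \<le> N" using R by (simp add: N_def)
      \<comment> \<open>The coordinate \<open>None\<close> carries \<open>q\<close>; its interval
        starts at \<open>Q\<close> and, since \<open>N \<ge> Q\<close>, contains the whole block up
        to \<open>2 * Q\<close>.\<close>
      define a where "a u = (case u of None \<Rightarrow> int Q | Some _ \<Rightarrow> - int (2 * Q * R + 1))"
        for u :: "'d option"
      define F where "F = (\<lambda>(q :: nat, b :: 'd \<Rightarrow> int) u. case u of None \<Rightarrow> int q | Some k \<Rightarrow> b k)"
      \<comment> \<open>The shift is 0 because \<open>\<alpha>\<close> is now a row of the
        matrix.\<close>
      let ?S = "{b \<in> PiE UNIV (\<lambda>u. {a u..<a u + int N}).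
        \<forall>k. dist_int (0 + (\<Sum>u\<in>UNIV. of_int (b u) * adjoin_row \<alpha> A $ u $ k)) < c * \<delta>}"
      have "inj_on F (approx_pairs \<alpha> A {Q..<2 * Q} Q R \<delta>)"
      proof (rule inj_onI)
        fix x y assume "F x = F y"
        then have "F x None = F y None" "\<And>k. F x (Some k) = F y (Some k)" by auto
        then show "x = y" by (cases x, cases y) (auto simp: F_def)
      qed
      moreover have "F ` approx_pairs \<alpha> A {Q..<2 * Q} Q R \<delta> \<subseteq> ?S"
      proof
        fix f assume "f \<in> F ` approx_pairs \<alpha> A {Q..<2 * Q} Q R \<delta>"
        then obtain q b where f: "f = F (q, b)" and qb: "(q, b) \<in> approx_pairs \<alpha> A {Q..<2 * Q} Q R \<delta>"
          by auto
        have "f u \<in> {a u..<a u + int N}" for u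
        proof (cases u)
          case None
          have "q \<in> {Q..<2 * Q}" using qb by (simp add: approx_pairs_def)
          then show ?thesis using None N by (auto simp: f F_def a_def)
        next
          case (Some k)
          then show ?thesis using qb by (auto simp: f F_def a_def approx_pairs_def N_def Pi_def PiE_def)
        qed
        moreover have "dist_int (0 + (\<Sum>u\<in>UNIV. of_int (f u) * adjoin_row \<alpha> A $ u $ k)) < c * \<delta>" for k
          using qb by (simp add: sum_UNIV_option f F_def adjoin_row_def approx_pairs_def c_def)
        ultimately show "f \<in> ?S" by auto
      qed
      moreover have "finite ?S"
        by (rule finite_subset[of _ "PiE UNIV (\<lambda>u. {a u..<a u + int N})"]) (auto intro: finite_PiE)
      ultimately have "card (approx_pairs \<alpha> A {Q..<2 * Q} Q R \<delta>) \<le> card ?S"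
        by (rule card_inj_on_le)
      then have "real (card (approx_pairs \<alpha> A {Q..<2 * Q} Q R \<delta>)) \<le> real (card ?S)" by simp
      also have "\<dots> \<le> C * (c * \<delta>) ^ CARD('m) * real N ^ CARD('d option)"
      proof (rule count)
        show "c * \<delta> \<ge> real N powr (- \<tau>)"
          using Q by (intro scaled_radius_ge[OF _ Q N \<tau>0 c]) (auto simp: \<delta>_def \<phi>_def)
      qed (use N Q in simp)
      finally have "real (card (approx_pairs \<alpha> A {Q..<2 * Q} Q R \<delta>)) * (2 * (\<delta> / real Q)) ^ CARD('d)
        \<le> C * (c * \<delta>) ^ CARD('m) * real N ^ CARD('d option) * (2 * (\<delta> / real Q)) ^ CARD('d)"
        using \<delta>0 by (intro mult_right_mono) auto
      \<comment> \<open>Of the \<open>d + 1\<close> factors \<open>N\<close>, \<open>d\<close>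
        cancel against the denominators \<open>Q\<close> up to constants; the remaining one supplies
        the factor \<open>Q\<close>.\<close>
      also have "\<dots> = C * (c * \<delta>) ^ CARD('m) * real N * (real N * (2 * (\<delta> / real Q))) ^ CARD('d)"
        by (simp only: card_option power_Suc power_mult_distrib mult.assoc)
      also have "real N * (2 * (\<delta> / real Q)) = 14 * real R * \<delta>"
        using Q by (simp add: N_def field_simps)
      also have "C * (c * \<delta>) ^ CARD('m) * real N * (14 * real R * \<delta>) ^ CARD('d)
          = (C * c ^ CARD('m) * (7 * real R) * (14 * real R) ^ CARD('d)) * (real Q * \<delta> ^ CARD('d + 'm))"
        by (simp add: power_mult_distrib power_add N_def)
      finally show "real (card (approx_pairs \<alpha> A {2 ^ t..<2 ^ Suc t} (2 ^ t) R (\<phi> (2 ^ t)))) *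
        (2 * (\<phi> (2 ^ t) / real (2 ^ t))) ^ CARD('d)
        \<le> (C * c ^ CARD('m) * (7 * real R) * (14 * real R) ^ CARD('d)) * (2 ^ t * \<phi> (2 ^ t) ^ CARD('d + 'm))"
        by (simp add: Q_def \<delta>_def)
    qed
  qed (auto simp: \<phi>0)
qed

theorem theorem1p1:
  fixes A :: "real ^ 'm ^ 'd" and \<alpha>\<^sub>0 :: "real ^ 'm"
  shows "(dioph_type A < ereal (real (CARD('d) * CARD('d + 'm))) \<longrightarrow>
      strong_Khintchine_convergence (aff_subspace \<alpha>\<^sub>0 A) (induced_lebesgue \<alpha>\<^sub>0 A)) \<and>
    (dioph_type (adjoin_row \<alpha>\<^sub>0 A) < ereal (real ((CARD('d) + 1) * CARD('d + 'm))) \<longrightarrow>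
      Khintchine_convergence (aff_subspace \<alpha>\<^sub>0 A) (induced_lebesgue \<alpha>\<^sub>0 A))"
  using strong_Khintchine_convergence_aff_subspace Khintchine_convergence_aff_subspace by blast

end
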